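(* Let $G=(V,E)$ be an $n$-vertex, $m$-edge graph with $n$ sufficiently large and $m\ge n\log^{10}n$, $b\in\mathbb{R}^V_{\ge0}$, $r\in\mathbb{R}^E_{\ge0}$, $N=\lceil\sqrt{\bar d}\rceil$, $T=\lfloor\log_2(N)/1000\rfloor$, and $\rho_t=N^{-0.2}\cdot100^t$. Couple $Sequential(G,b,r,T)$ and $OneRoundMPC(G,b,r)$ by using the same random thresholds. Then for every $v\in V$ and every $t\in\{0,1,\dots,T\}$, $\Pr[v\in V_t^{active}\triangle\tilde V_t^{active}]\le \frac{t}{n}+\sum_{\ell=0}^t\rho_\ell$.
   Context: $E(v)$ is the set of edges incident to $v$, $\bar d=2m/n$, $\triangle$ denotes symmetric difference. Thresholds $\mathcal{T}_{v,t}\sim\mathcal{U}[0.2b_v,0.4b_v]$ independent; $q_v=0.8b_v/\max(|E(v)|,\bar d)$; $x_{e,0}=\tilde x_{e,0}=\min(r_e,q_u,q_v)$. $Sequential$: $V_0^{active}=V$; for $t=1..T$: $y_{v,t-1}=\sum_{e\in E(v)}x_{e,t-1}$, $V_t^{active}=\{v\in V_{t-1}^{active}:y_{v,t-1}\le\mathcal{T}_{v,t}\}$, $E_t^{active}=\{e=\{u,v\}:u,v\in V_t^{active},x_{e,t-1}\le r_e/2\}$, $x_{e,t}=2x_{e,t-1}$ on $E_t^{active}$, else unchanged. $OneRoundMPC$: each $v$ independently picks $i_v$ uniformly in $\{1..N\}$; $E^{local}(v)=\{\{u,v\}\in E:i_u=i_v\}$; $\tilde V_0^{active}=V$; for $t=1..T$: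 $\tilde y_{v,t-1}=N\sum_{e\in E^{local}(v)}\tilde x_{e,t-1}$, $\tilde V_t^{active}=\{v\in\tilde V_{t-1}^{active}:\tilde y_{v,t-1}\le\mathcal{T}_{v,t}\}$, $\tilde E_t^{active}=\{e=\{u,v\}:u,v\in\tilde V_t^{active},\tilde x_{e,t-1}\le r_e/2\}$, $\tilde x_{e,t}=2\tilde x_{e,t-1}$ on $\tilde E_t^{active}$, else unchanged. *)

theory Defs
  imports "HOL-Probability.Probability"
begin

definition simple_graph :: "'v set \<Rightarrow> 'v set set \<Rightarrow> bool" where
  "simple_graph V E \<longleftrightarrow> finite V \<and> E \<subseteq> {{u, v} |u v. u \<in> V \<and> v \<in> V \<and> u \<noteq> v}"

definition incident_edges :: "'v set set \<Rightarrow> 'v \<Rightarrow> 'v set set" where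
  "incident_edges E v = {e \<in> E. v \<in> e}"

definition avg_degree :: "'v set \<Rightarrow> 'v set set \<Rightarrow> real" where
  "avg_degree V E = 2 * real (card E) / real (card V)"

definition num_machines :: "'v set \<Rightarrow> 'v set set \<Rightarrow> nat" where
  "num_machines V E = nat \<lceil>sqrt (avg_degree V E)\<rceil>"

definition num_rounds :: "'v set \<Rightarrow> 'v set set \<Rightarrow> nat" where
  "num_rounds V E = nat \<lfloor>log 2 (real (num_machines V E)) / 1000\<rfloor>"

definition rho :: "'v set \<Rightarrow> 'v set set \<Rightarrow> nat \<Rightarrow> real" where
  "rho V E t = real (num_machines V E) powr (- 0.2) * 100 ^ t"

definition vertex_cap :: "'v set \<Rightarrow> 'v set set \<Rightarrow> ('v \<Rightarrow> real) \<Rightarrow> 'v \<Rightarrow> real" where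
  "vertex_cap V E b v = 0.8 * b v / max (real (card (incident_edges E v))) (avg_degree V E)"

text \<open>For an edge \<open>e = {u, v}\<close> this is the minimum of \<open>r e\<close> and the caps of \<open>u\<close> and \<open>v\<close>.\<close>
definition init_value ::
  "'v set \<Rightarrow> 'v set set \<Rightarrow> ('v \<Rightarrow> real) \<Rightarrow> ('v set \<Rightarrow> real) \<Rightarrow> 'v set \<Rightarrow> real" where
  "init_value V E b r e = min (r e) (Min (vertex_cap V E b ` e))"

definition local_edges :: "'v set set \<Rightarrow> ('v \<Rightarrow> nat) \<Rightarrow> 'v \<Rightarrow> 'v set set" where
  "local_edges E i v = {{u, v} |u. {u, v} \<in> E \<and> i u = i v}"

text \<open>A sample \<open>thr\<close> of the thresholds is indexed by pairs of a vertex and an iteration, and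
  \<open>i\<close> is a sample of the machine assignment.  Both processes are deterministic functions
  of these samples.\<close>

context
  fixes V :: "'v set" and E :: "'v set set" and b :: "'v \<Rightarrow> real" and r :: "'v set \<Rightarrow> real"
    and thr :: "'v \<times> nat \<Rightarrow> real"
begin

fun seq_active :: "nat \<Rightarrow> 'v set" and seq_value :: "nat \<Rightarrow> 'v set \<Rightarrow> real" where
  "seq_active 0 = V"
| "seq_active (Suc t) =
     {v \<in> seq_active t. (\<Sum>e \<in> incident_edges E v. seq_value t e) \<le> thr (v, Suc t)}"
| "seq_value 0 e = init_value V E b r e"
| "seq_value (Suc t) e =
     (if e \<in> E \<and> e \<subseteq> seq_active (Suc t) \<and> seq_value t e \<le> r e / 2
      then 2 * seq_value t e else seq_value t e)"

end

context
  fixes V :: "'v set" and E :: "'v set set" and b :: "'v \<Rightarrow> real" and r :: "'v set \<Rightarrow> real"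
    and thr :: "'v \<times> nat \<Rightarrow> real" and i :: "'v \<Rightarrow> nat"
begin

fun mpc_active :: "nat \<Rightarrow> 'v set" and mpc_value :: "nat \<Rightarrow> 'v set \<Rightarrow> real" where
  "mpc_active 0 = V"
| "mpc_active (Suc t) =
     {v \<in> mpc_active t.
        real (num_machines V E) * (\<Sum>e \<in> local_edges E i v. mpc_value t e) \<le> thr (v, Suc t)}"
| "mpc_value 0 e = init_value V E b r e"
| "mpc_value (Suc t) e =
     (if e \<in> E \<and> e \<subseteq> mpc_active (Suc t) \<and> mpc_value t e \<le> r e / 2
      then 2 * mpc_value t e else mpc_value t e)"

end

text \<open>The uniform distribution on \<open>[l, u]\<close>.  For \<open>l = u\<close> (a vertex with \<open>b v = 0\<close>) it is the
  point mass, whereas \<open>uniform_measure\<close> on a null set would be the null measure.\<close>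
definition uniform_interval :: "real \<Rightarrow> real \<Rightarrow> real measure" where
  "uniform_interval l u = (if l < u then uniform_measure lborel {l..u} else return lborel l)"

text \<open>Joint law of the thresholds shared by both processes and of the independent machine
  assignment.\<close>
definition coupling ::
  "'v set \<Rightarrow> 'v set set \<Rightarrow> ('v \<Rightarrow> real) \<Rightarrow> (('v \<times> nat \<Rightarrow> real) \<times> ('v \<Rightarrow> nat)) measure" where
  "coupling V E b =
     (\<Pi>\<^sub>M p \<in> V \<times> {1..num_rounds V E}. uniform_interval (0.2 * b (fst p)) (0.4 * b (fst p)))
       \<Otimes>\<^sub>M (\<Pi>\<^sub>M v \<in> V. uniform_count_measure {1..num_machines V E})"

lemma prob_space_uniform_interval: "prob_space (uniform_interval l u)"
proof (cases "l < u")
  case True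
  then show ?thesis
    unfolding uniform_interval_def by (auto intro!: prob_space_uniform_measure)
next
  case False
  then show ?thesis
    unfolding uniform_interval_def by (auto intro!: prob_space_return)
qed

lemma sets_uniform_interval [simp, measurable_cong]: "sets (uniform_interval l u) = sets borel"
  by (simp add: uniform_interval_def)

lemma prob_space_coupling:
  assumes "num_machines V E > 0"
  shows "prob_space (coupling V E b)"
proof -
  have "prob_space (\<Pi>\<^sub>M p \<in> V \<times> {1..num_rounds V E}.
          uniform_interval (0.2 * b (fst p)) (0.4 * b (fst p)))"
    by (intro prob_space_PiM prob_space_uniform_interval)
  moreover have "prob_space (\<Pi>\<^sub>M v \<in> V. uniform_count_measure {1..num_machines V E})"
    using assms by (intro prob_space_PiM prob_space_uniform_count_measure) auto
  ultimately show ?thesis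
    unfolding coupling_def by (rule prob_space_pair)
qed

lemma sets_coupling:
  "sets (coupling V E b) = sets ((\<Pi>\<^sub>M p \<in> V \<times> {1..num_rounds V E}. (borel :: real measure))
     \<Otimes>\<^sub>M (\<Pi>\<^sub>M v \<in> V. count_space {1..num_machines V E}))"
  unfolding coupling_def
  by (intro sets_pair_measure_cong sets_PiM_cong)
     (auto simp: sets_uniform_count_measure)

lemma simple_graph_finite_edges:
  assumes "simple_graph V E"
  shows "finite E"
proof (rule finite_subset)
  show "E \<subseteq> Pow V" using assms by (auto simp: simple_graph_def)
  show "finite (Pow V)" using assms by (simp add: simple_graph_def)
qed

lemma simple_graph_edgeD:
  assumes "simple_graph V E" "e \<in> E"
  shows "finite e" "e \<subseteq> V"
  using assms by (auto simp: simple_graph_def)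

lemma sum_local_edges:
  assumes "simple_graph V E"
  shows "(\<Sum>e \<in> local_edges E i v. f e) =
         (\<Sum>e \<in> incident_edges E v. if \<forall>u\<in>e. i u = i v then f e else 0)"
proof -
  have "local_edges E i v = {e \<in> incident_edges E v. \<forall>u\<in>e. i u = i v}"
  proof (intro set_eqI iffI)
    fix e assume "e \<in> {e \<in> incident_edges E v. \<forall>u\<in>e. i u = i v}"
    then have e: "e \<in> E" "v \<in> e" "\<forall>u\<in>e. i u = i v"
      unfolding incident_edges_def by blast+
    then obtain x y where xy: "e = {x, y}" using assms unfolding simple_graph_def by blast
    have "\<exists>u. e = {u, v}" using e(2) unfolding xy by blast
    then obtain u where "e = {u, v}" ..
    with e have "e = {u, v} \<and> {u, v} \<in> E \<and> i u = i v" by blast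
    then show "e \<in> local_edges E i v" unfolding local_edges_def by blast
  next
    fix e assume "e \<in> local_edges E i v"
    then obtain u where "e = {u, v}" "{u, v} \<in> E" "i u = i v"
      unfolding local_edges_def by blast
    then show "e \<in> {e \<in> incident_edges E v. \<forall>u\<in>e. i u = i v}"
      by (simp add: incident_edges_def)
  qed
  moreover have "finite (incident_edges E v)"
    using simple_graph_finite_edges[OF assms] by (simp add: incident_edges_def)
  ultimately show ?thesis
    by (simp only: sum.inter_filter)
qed

lemma measurable_coupling_thr:
  assumes "v \<in> V" "t \<in> {1..num_rounds V E}"
  shows "(\<lambda>\<omega>. fst \<omega> (v, t)) \<in> borel_measurable (coupling V E b)"
proof -
  have "(v, t) \<in> V \<times> {1..num_rounds V E}" using assms by simp
  then show ?thesis
    unfolding measurable_cong_sets[OF sets_coupling refl] by measurable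
qed

lemma measurable_coupling_machine:
  assumes "v \<in> V"
  shows "(\<lambda>\<omega>. snd \<omega> v) \<in> measurable (coupling V E b) (count_space UNIV)"
proof -
  have "(\<lambda>\<omega>. snd \<omega> v) \<in> measurable (coupling V E b) (count_space {1..num_machines V E})"
    using assms unfolding measurable_cong_sets[OF sets_coupling refl] by measurable
  then show ?thesis
    by (rule measurable_compose) simp
qed

lemma measurable_seq:
  assumes G: "simple_graph V E" and "t \<le> num_rounds V E"
  shows "(\<forall>v\<in>V. Measurable.pred (coupling V E b) (\<lambda>\<omega>. v \<in> seq_active V E b r (fst \<omega>) t)) \<and>
         (\<forall>e\<in>E. (\<lambda>\<omega>. seq_value V E b r (fst \<omega>) t e) \<in> borel_measurable (coupling V E b))"
  using assms(2)
proof (induction t)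
  case 0
  then show ?case by simp
next
  case (Suc t)
  then have IH1 [measurable]: "v \<in> V \<Longrightarrow> Measurable.pred (coupling V E b) (\<lambda>\<omega>. v \<in> seq_active V E b r (fst \<omega>) t)"
    and IH2 [measurable]: "e \<in> E \<Longrightarrow> (\<lambda>\<omega>. seq_value V E b r (fst \<omega>) t e) \<in> borel_measurable (coupling V E b)"
    for v e by auto
  have A [measurable]: "Measurable.pred (coupling V E b) (\<lambda>\<omega>. v \<in> seq_active V E b r (fst \<omega>) (Suc t))"
    if v: "v \<in> V" for v
  proof -
    have [measurable]: "(\<lambda>\<omega>. fst \<omega> (v, Suc t)) \<in> borel_measurable (coupling V E b)"
      using v Suc.prems by (intro measurable_coupling_thr) auto
    have [measurable]: "(\<lambda>\<omega>. \<Sum>e \<in> incident_edges E v. seq_value V E b r (fst \<omega>) t e) \<in> borel_measurable (coupling V E b)"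
      by (intro borel_measurable_sum IH2) (auto simp: incident_edges_def)
    show ?thesis using IH1[OF v] by simp
  qed
  have "(\<lambda>\<omega>. seq_value V E b r (fst \<omega>) (Suc t) e) \<in> borel_measurable (coupling V E b)"
    if e: "e \<in> E" for e
  proof -
    have [measurable]: "Measurable.pred (coupling V E b) (\<lambda>\<omega>. \<forall>u\<in>e. u \<in> seq_active V E b r (fst \<omega>) (Suc t))"
      using simple_graph_edgeD[OF G e] by (intro pred_intros_finite A) auto
    note IH2[OF e, measurable]
    show ?thesis
      unfolding seq_value.simps(2) subset_eq by measurable
  qed
  with A show ?case by blast
qed

lemma measurable_mpc:
  assumes G: "simple_graph V E" and "t \<le> num_rounds V E"
  shows "(\<forall>v\<in>V. Measurable.pred (coupling V E b) (\<lambda>\<omega>. v \<in> mpc_active V E b r (fst \<omega>) (snd \<omega>) t)) \<and>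
         (\<forall>e\<in>E. (\<lambda>\<omega>. mpc_value V E b r (fst \<omega>) (snd \<omega>) t e) \<in> borel_measurable (coupling V E b))"
  using assms(2)
proof (induction t)
  case 0
  then show ?case by simp
next
  case (Suc t)
  then have IH1: "v \<in> V \<Longrightarrow> Measurable.pred (coupling V E b) (\<lambda>\<omega>. v \<in> mpc_active V E b r (fst \<omega>) (snd \<omega>) t)"
    and IH2: "e \<in> E \<Longrightarrow> (\<lambda>\<omega>. mpc_value V E b r (fst \<omega>) (snd \<omega>) t e) \<in> borel_measurable (coupling V E b)"
    for v e by auto
  have A: "Measurable.pred (coupling V E b) (\<lambda>\<omega>. v \<in> mpc_active V E b r (fst \<omega>) (snd \<omega>) (Suc t))"
    if v: "v \<in> V" for v
  proof -
    have [measurable]: "(\<lambda>\<omega>. fst \<omega> (v, Suc t)) \<in> borel_measurable (coupling V E b)"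
      using v Suc.prems by (intro measurable_coupling_thr) auto
    have S: "(\<lambda>\<omega>. if \<forall>u\<in>e. snd \<omega> u = snd \<omega> v then mpc_value V E b r (fst \<omega>) (snd \<omega>) t e else 0)
              \<in> borel_measurable (coupling V E b)" if "e \<in> incident_edges E v" for e
    proof -
      from that have e: "e \<in> E" by (simp add: incident_edges_def)
      have P: "Measurable.pred (coupling V E b) (\<lambda>\<omega>. snd \<omega> u = snd \<omega> v)" if "u \<in> e" for u
      proof -
        have "u \<in> V" using simple_graph_edgeD[OF G e] that by auto
        then have [measurable]: "(\<lambda>\<omega>. real (snd \<omega> u)) \<in> borel_measurable (coupling V E b)"
          "(\<lambda>\<omega>. real (snd \<omega> v)) \<in> borel_measurable (coupling V E b)"
          using v by (auto intro!: measurable_compose[OF measurable_coupling_machine])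
        have "Measurable.pred (coupling V E b) (\<lambda>\<omega>. real (snd \<omega> u) = real (snd \<omega> v))"
          by measurable
        then show ?thesis by simp
      qed
      have [measurable]: "Measurable.pred (coupling V E b) (\<lambda>\<omega>. \<forall>u\<in>e. snd \<omega> u = snd \<omega> v)"
        using simple_graph_edgeD[OF G e] by (intro pred_intros_finite P) auto
      note IH2[OF e, measurable]
      show ?thesis by measurable
    qed
    have [measurable]: "(\<lambda>\<omega>. \<Sum>e \<in> local_edges E (snd \<omega>) v. mpc_value V E b r (fst \<omega>) (snd \<omega>) t e)
        \<in> borel_measurable (coupling V E b)"
      unfolding sum_local_edges[OF G] by (intro borel_measurable_sum S)
    show ?thesis using IH1[OF v] by simp
  qed
  have "(\<lambda>\<omega>. mpc_value V E b r (fst \<omega>) (snd \<omega>) (Suc t) e) \<in> borel_measurable (coupling V E b)"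
    if e: "e \<in> E" for e
  proof -
    have [measurable]: "Measurable.pred (coupling V E b) (\<lambda>\<omega>. \<forall>u\<in>e. u \<in> mpc_active V E b r (fst \<omega>) (snd \<omega>) (Suc t))"
      using simple_graph_edgeD[OF G e] by (intro pred_intros_finite A) auto
    note IH2[OF e, measurable]
    show ?thesis
      unfolding mpc_value.simps(2) subset_eq by measurable
  qed
  with A show ?case by blast
qed

lemma sym_diff_event_measurable:
  assumes "simple_graph V E" "t \<le> num_rounds V E" "v \<in> V"
  shows "{(thr, i) \<in> space (coupling V E b).
            v \<in> sym_diff (seq_active V E b r thr t) (mpc_active V E b r thr i t)}
         \<in> sets (coupling V E b)"
proof -
  note [measurable] = measurable_seq[OF assms(1,2), THEN conjunct1, rule_format, OF assms(3), of b r]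
    measurable_mpc[OF assms(1,2), THEN conjunct1, rule_format, OF assms(3), of b r]
  have "{\<omega> \<in> space (coupling V E b). v \<in> sym_diff (seq_active V E b r (fst \<omega>) t)
          (mpc_active V E b r (fst \<omega>) (snd \<omega>) t)} \<in> sets (coupling V E b)"
    unfolding Un_iff Diff_iff by measurable
  moreover have "{\<omega> \<in> space (coupling V E b). v \<in> sym_diff (seq_active V E b r (fst \<omega>) t)
          (mpc_active V E b r (fst \<omega>) (snd \<omega>) t)} =
        {(thr, i) \<in> space (coupling V E b).
            v \<in> sym_diff (seq_active V E b r thr t) (mpc_active V E b r thr i t)}"
    by auto
  ultimately show ?thesis by argo
qed

end

theory Submission
  imports Defs
begin

text \<open>
  Besides the loads of the two processes consider the sampled load of \<open>v\<close>: the sequential values of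
  its local edges, scaled by the number \<open>N\<close> of machines.  Fixing the thresholds and the machine of
  \<open>v\<close>, a Chernoff bound over the other machines puts it within \<open>\<epsilon> b\<^sub>v\<close> of the sequential load, where
  \<open>\<epsilon> = N\<^bsup>-0.2\<^esup>\<close>.

  Expectations alone do not suffice to propagate this, since the value of an edge is correlated
  with the divergence of its endpoints. Instead one maintains, with high probability and for all
  vertices at once, that the loads of a vertex on which the processes have agreed up to round
  \<open>t\<close> differ by at most \<open>\<delta>\<^sub>t b\<^sub>v\<close> with
  \<open>\<delta>\<^sub>t = 13\<^sup>t \<epsilon>\<close>. Given the machines and the thresholds
  of all other rounds, the fresh thresholds separate the two loads of each neighbour independently
  with probability at most \<open>5 \<delta>\<^sub>t\<close>, so by Chernoff the newly diverged
  local neighbours carry weight at most \<open>10 \<delta>\<^sub>t\<close> times the sampled load,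
  plus \<open>\<epsilon> b\<^sub>v\<close>. Edge values at most double per round, which closes the
  recursion. The Chernoff failures cost \<open>1/n\<close> per round, and \<open>v\<close> itself
  diverges in round \<open>t + 1\<close> with probability at most \<open>5 \<delta>\<^sub>t\<close>.
\<close>

section \<open>Tail bounds in product spaces\<close>

text \<open>The negative range is needed because lower tails are obtained from negated weights.
  There the quadratic Taylor lower bound for \<open>exp (- x)\<close> is inverted.\<close>

lemma exp_le_1_plus_sq:
  fixes x :: real
  assumes "\<bar>x\<bar> \<le> 1"
  shows "exp x \<le> 1 + x + x\<^sup>2"
proof (cases "x \<ge> 0")
  case True
  then show ?thesis using assms exp_bound[of x] by simp
next
  case False
  define y where "y = - x"
  have y: "0 < y" "y \<le> 1" using False assms by (auto simp: y_def)
  have "1 + y + y\<^sup>2 / 2 \<le> exp y"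
    using exp_lower_Taylor_quadratic[of y] y by simp
  then have "1 / exp y \<le> 1 / (1 + y + y\<^sup>2 / 2)"
    using y by (intro divide_left_mono) (auto intro!: mult_pos_pos add_pos_nonneg)
  also have "\<dots> \<le> 1 - y + y\<^sup>2"
  proof -
    have "1 \<le> (1 - y + y\<^sup>2) * (1 + y + y\<^sup>2 / 2)"
    proof -
      have "(1 - y + y\<^sup>2) * (1 + y + y\<^sup>2 / 2) = 1 + y\<^sup>2 / 2 + y ^ 3 / 2 + y ^ 4 / 2"
        by (simp add: power2_eq_square power3_eq_cube power4_eq_xxxx field_simps)
      then show ?thesis using y by simp
    qed
    then show ?thesis using y by (subst pos_divide_le_eq) (auto intro!: add_pos_nonneg)
  qed
  finally show ?thesis by (simp add: y_def exp_minus field_simps)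
qed

text \<open>This and the next two lemmas stand in for conditioning: by Tonelli, a bound valid on
  every slice survives averaging, so no conditional probabilities have to be formed.\<close>

lemma emeasure_pair_le_slice1:
  assumes "prob_space M" "prob_space N" and S: "S \<in> sets (M \<Otimes>\<^sub>M N)"
    and le: "\<And>x. x \<in> space M \<Longrightarrow> emeasure N {y \<in> space N. (x, y) \<in> S} \<le> c"
  shows "emeasure (M \<Otimes>\<^sub>M N) S \<le> c"
proof -
  interpret M: prob_space M by fact
  interpret N: prob_space N by fact
  have "Pair x -` S = {y \<in> space N. (x, y) \<in> S}" for x
    using sets.sets_into_space[OF S] by (auto simp: space_pair_measure)
  then have "emeasure (M \<Otimes>\<^sub>M N) S = (\<integral>\<^sup>+x. emeasure N {y \<in> space N. (x, y) \<in> S} \<partial>M)"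
    using N.emeasure_pair_measure_alt[OF S] by simp
  also have "\<dots> \<le> (\<integral>\<^sup>+x. c \<partial>M)" by (intro nn_integral_mono le)
  also have "\<dots> = c" by (simp add: M.emeasure_space_1)
  finally show ?thesis .
qed

lemma emeasure_pair_le_slice2:
  assumes "prob_space M" "prob_space N" and S: "S \<in> sets (M \<Otimes>\<^sub>M N)"
    and le: "\<And>y. y \<in> space N \<Longrightarrow> emeasure M {x \<in> space M. (x, y) \<in> S} \<le> c"
  shows "emeasure (M \<Otimes>\<^sub>M N) S \<le> c"
proof -
  interpret M: prob_space M by fact
  interpret N: prob_space N by fact
  interpret P: pair_sigma_finite M N ..
  have "(\<lambda>x. (x, y)) -` S = {x \<in> space M. (x, y) \<in> S}" for y
    using sets.sets_into_space[OF S] by (auto simp: space_pair_measure)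
  then have "emeasure (M \<Otimes>\<^sub>M N) S = (\<integral>\<^sup>+y. emeasure M {x \<in> space M. (x, y) \<in> S} \<partial>N)"
    using P.emeasure_pair_measure_alt2[OF S] by simp
  also have "\<dots> \<le> (\<integral>\<^sup>+y. c \<partial>N)" by (intro nn_integral_mono le)
  also have "\<dots> = c" by (simp add: N.emeasure_space_1)
  finally show ?thesis .
qed

text \<open>The same principle inside one product space: the coordinates in \<open>I\<close> are
  frozen at \<open>x\<close> and only those in \<open>J\<close> are resampled.\<close>

lemma emeasure_PiM_le_slice:
  assumes M: "\<And>i. prob_space (M i)" and fin: "finite I" "finite J" and disj: "I \<inter> J = {}"
    and S: "S \<in> sets (Pi\<^sub>M (I \<union> J) M)"
    and le: "\<And>x. x \<in> space (Pi\<^sub>M I M) \<Longrightarrow>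
      emeasure (Pi\<^sub>M J M) {y \<in> space (Pi\<^sub>M J M). merge I J (x, y) \<in> S} \<le> c"
  shows "emeasure (Pi\<^sub>M (I \<union> J) M) S \<le> c"
proof -
  interpret product_prob_space M by (intro product_prob_spaceI M)
  note S[measurable]
  have "emeasure (Pi\<^sub>M (I \<union> J) M) S = (\<integral>\<^sup>+ x. (\<integral>\<^sup>+ y. indicator S (merge I J (x, y)) \<partial>(Pi\<^sub>M J M))
    \<partial>(Pi\<^sub>M I M))"
    by (subst product_nn_integral_fold[OF disj fin, symmetric]) (auto simp: S)
  also have "\<dots> \<le> (\<integral>\<^sup>+ x. c \<partial>(Pi\<^sub>M I M))"
  proof (rule nn_integral_mono)
    fix x assume x: "x \<in> space (Pi\<^sub>M I M)"
    have [measurable]: "(\<lambda>y. merge I J (x, y)) \<in> measurable (Pi\<^sub>M J M) (Pi\<^sub>M (I \<union> J) M)"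
      using x by measurable
    have "(\<integral>\<^sup>+ y. indicator S (merge I J (x, y)) \<partial>(Pi\<^sub>M J M))
        = (\<integral>\<^sup>+ y. indicator {y \<in> space (Pi\<^sub>M J M). merge I J (x, y) \<in> S} y \<partial>(Pi\<^sub>M J M))"
      by (intro nn_integral_cong) (auto simp: indicator_def)
    also have "\<dots> = emeasure (Pi\<^sub>M J M) {y \<in> space (Pi\<^sub>M J M). merge I J (x, y) \<in> S}"
      by (rule nn_integral_indicator) measurable
    also have "\<dots> \<le> c" by (rule le[OF x])
    finally show "(\<integral>\<^sup>+ y. indicator S (merge I J (x, y)) \<partial>(Pi\<^sub>M J M)) \<le> c" .
  qed
  also have "\<dots> = c"
    using prob_space.emeasure_space_1[OF prob_space_PiM[of I M, OF M]] by simp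
  finally show ?thesis .
qed

lemma emeasure_PiM_component_set:
  assumes M: "\<And>i. i \<in> I \<Longrightarrow> prob_space (M i)" and "j \<in> I" "A \<in> sets (M j)"
  shows "emeasure (Pi\<^sub>M I M) {x \<in> space (Pi\<^sub>M I M). x j \<in> A} = emeasure (M j) A"
proof -
  have "emeasure (M j) A = emeasure (distr (Pi\<^sub>M I M) (M j) (\<lambda>\<omega>. \<omega> j)) A"
    using distr_PiM_component[of I M j] assms by simp
  also have "\<dots> = emeasure (Pi\<^sub>M I M) {x \<in> space (Pi\<^sub>M I M). x j \<in> A}"
    using assms by (subst emeasure_distr) (auto intro!: arg_cong[where f="emeasure _"])
  finally show ?thesis by simp
qed

text \<open>Exponential Markov with the parameter fixed at 1, so callers scale the weights
  \<open>a\<close> instead. Weights of either sign are allowed, which yields both tails. The excess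
  \<open>p i * (a i)\<^sup>2\<close> in the threshold is the second-order term of the moment
  generating function.\<close>

lemma chernoff_PiM:
  fixes a p :: "'i \<Rightarrow> real"
  assumes M: "\<And>i. prob_space (M i)" and fin: "finite I"
    and A: "\<And>i. i \<in> I \<Longrightarrow> A i \<in> sets (M i)"
    and p: "\<And>i. i \<in> I \<Longrightarrow> p i = measure (M i) (A i)"
    and a: "\<And>i. i \<in> I \<Longrightarrow> \<bar>a i\<bar> \<le> 1"
  shows "emeasure (Pi\<^sub>M I M) {x \<in> space (Pi\<^sub>M I M).
           (\<Sum>i\<in>I. a i * indicator (A i) (x i)) \<ge> (\<Sum>i\<in>I. p i * (a i + (a i)\<^sup>2)) + L} \<le> ennreal (exp
             (- L))"
proof -
  interpret product_prob_space M by (intro product_prob_spaceI M)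
  define mu where "mu = (\<Sum>i\<in>I. p i * (a i + (a i)\<^sup>2))"
  define f where "f = (\<lambda>x. \<Sum>i\<in>I. a i * indicator (A i) (x i) :: real)"
  have [measurable]: "(\<lambda>x. indicator (A i) (x i) :: real) \<in> borel_measurable (Pi\<^sub>M I M)" if "i \<in>
    I" for i
    using that A[OF that] by measurable
  have [measurable]: "f \<in> borel_measurable (Pi\<^sub>M I M)"
    unfolding f_def by measurable
  have one: "(\<integral>\<^sup>+ z. ennreal (exp (a i * indicator (A i) z)) \<partial>M i) \<le> ennreal (exp (p i * (a i + (a
    i)\<^sup>2)))"
    if i: "i \<in> I" for i
  proof -
    note A[OF i, measurable]
    \<comment> \<open>The exponent takes only the values 0 and \<open>a i\<close>, so the
      exponential is affine in the indicator and integrates to an expression in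
      \<open>p i\<close>.\<close>
    have eq: "exp (a i * indicator (A i) z) = 1 + (exp (a i) - 1) * indicator (A i) z" for z
      by (auto simp: indicator_def)
    have int: "integrable (M i) (\<lambda>z. 1 + (exp (a i) - 1) * indicator (A i) z)"
      by (intro integrable_const Bochner_Integration.integrable_add integrable_mult_right) (auto
        simp: M.emeasure_eq_measure)
    have "(\<integral>\<^sup>+ z. ennreal (exp (a i * indicator (A i) z)) \<partial>M i)
        = ennreal (\<integral> z. exp (a i * indicator (A i) z) \<partial>M i)"
      by (intro nn_integral_eq_integral AE_I2) (use int in \<open>simp_all only: eq[symmetric]
        exp_ge_zero\<close>)
    also have "(\<integral> z. exp (a i * indicator (A i) z) \<partial>M i) = 1 + (exp (a i) - 1) * p i"
      unfolding eq using i
      by (subst Bochner_Integration.integral_add) (auto simp: p M.prob_space M.emeasure_eq_measure)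
    also have "\<dots> \<le> 1 + (a i + (a i)\<^sup>2) * p i"
      using exp_le_1_plus_sq[OF a[OF i]] p[OF i] by (intro add_left_mono mult_right_mono) auto
    also have "\<dots> \<le> exp (p i * (a i + (a i)\<^sup>2))"
      using exp_ge_add_one_self[of "p i * (a i + (a i)\<^sup>2)"] by (simp add: mult.commute)
    finally show ?thesis by (simp add: ennreal_leI)
  qed
  have mgf: "(\<integral>\<^sup>+ x. ennreal (exp (f x)) \<partial>Pi\<^sub>M I M) \<le> ennreal (exp mu)"
  proof -
    have "(\<integral>\<^sup>+ x. ennreal (exp (f x)) \<partial>Pi\<^sub>M I M)
        = (\<integral>\<^sup>+ x. (\<Prod>i\<in>I. ennreal (exp (a i * indicator (A i) (x i)))) \<partial>Pi\<^sub>M I M)"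
      by (simp only: f_def exp_sum[OF fin] prod_ennreal exp_ge_zero)
    also have "\<dots> = (\<Prod>i\<in>I. \<integral>\<^sup>+ z. ennreal (exp (a i * indicator (A i) z)) \<partial>M i)"
      by (rule product_nn_integral_prod[OF fin]) (use A in measurable)
    also have "\<dots> \<le> (\<Prod>i\<in>I. ennreal (exp (p i * (a i + (a i)\<^sup>2))))"
      by (intro prod_mono_ennreal one)
    also have "\<dots> = ennreal (exp mu)"
      by (simp add: mu_def exp_sum fin prod_ennreal)
    finally show ?thesis .
  qed
  have "emeasure (Pi\<^sub>M I M) {x \<in> space (Pi\<^sub>M I M). f x \<ge> mu + L}
     \<le> ennreal (exp (- 1 * (mu + L))) * (\<integral>\<^sup>+x\<in>space (Pi\<^sub>M I M). ennreal (exp (1 * f x)) \<partial>Pi\<^sub>M I M)"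
    by (rule Chernoff_ineq_nn_integral_ge) auto
  also have "\<dots> = ennreal (exp (- (mu + L))) * (\<integral>\<^sup>+x. ennreal (exp (f x)) \<partial>Pi\<^sub>M I M)"
    by (intro arg_cong2[where f="(*)"] nn_integral_cong) auto
  also have "\<dots> \<le> ennreal (exp (- (mu + L))) * ennreal (exp mu)"
    by (intro mult_left_mono mgf) auto
  also have "\<dots> = ennreal (exp (- L))"
    by (simp add: ennreal_mult[symmetric] exp_add[symmetric])
  finally show ?thesis by (simp add: f_def mu_def)
qed

lemma emeasure_uniform_interval_le:
  assumes "l < u" "x \<le> y"
  shows "emeasure (uniform_interval l u) {x..<y} \<le> ennreal ((y - x) / (u - l))"
proof -
  have "emeasure (uniform_interval l u) {x..<y} = emeasure lborel ({l..u} \<inter> {x..<y}) / emeasure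
    lborel {l..u}"
    using assms by (simp add: uniform_interval_def)
  also have "\<dots> \<le> emeasure lborel {x..<y} / emeasure lborel {l..u}"
    by (intro divide_right_mono_ennreal emeasure_mono) auto
  also have "\<dots> = ennreal ((y - x) / (u - l))"
    using assms by (simp add: divide_ennreal)
  finally show ?thesis .
qed

lemma emeasure_uniform_interval_greaterThan:
  assumes "l \<le> u"
  shows "emeasure (uniform_interval l u) {u<..} = 0"
proof -
  have "{l..u} \<inter> {u<..} = {}" by auto
  then show ?thesis using assms by (simp add: uniform_interval_def)
qed

section \<open>Propagation of the divergence\<close>

text \<open>The largeness of \<open>n\<close> and the density of the graph enter only later, through
  numerical conditions on \<theta>, \<open>c\<close>, \<open>L\<close> and \<epsilon>.\<close>

locale coupled_run =
  fixes V :: "'v set" and E :: "'v set set" and b :: "'v \<Rightarrow> real" and r :: "'v set \<Rightarrow> real"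
  assumes graph: "simple_graph V E" and avg_degree_pos: "avg_degree V E > 0"
    and b_nonneg: "\<And>v. v \<in> V \<Longrightarrow> b v \<ge> 0" and r_nonneg: "\<And>e. e \<in> E \<Longrightarrow> r e \<ge> 0"
begin

abbreviation "machines \<equiv> num_machines V E"
abbreviation "rounds \<equiv> num_rounds V E"
abbreviation "sa \<equiv> seq_active V E b r"
abbreviation "sx \<equiv> seq_value V E b r"
abbreviation "ma \<equiv> mpc_active V E b r"
abbreviation "mx \<equiv> mpc_value V E b r"

text \<open>Loads are indexed by neighbours instead of edges, so that their summands match the
  vertex-indexed coordinates of the product measures.\<close>

definition nbrs :: "'v \<Rightarrow> 'v set" where
  "nbrs v = {u. {u, v} \<in> E}"

definition seq_load :: "('v \<times> nat \<Rightarrow> real) \<Rightarrow> nat \<Rightarrow> 'v \<Rightarrow> real" where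
  "seq_load thr t v = (\<Sum>u\<in>nbrs v. sx thr t {u, v})"

definition sampled_load :: "('v \<times> nat \<Rightarrow> real) \<Rightarrow> ('v \<Rightarrow> nat) \<Rightarrow> nat \<Rightarrow> 'v \<Rightarrow> real" where
  "sampled_load thr i t v =
     real machines * (\<Sum>u\<in>nbrs v. if i u = i v then sx thr t {u, v} else 0)"

definition mpc_load :: "('v \<times> nat \<Rightarrow> real) \<Rightarrow> ('v \<Rightarrow> nat) \<Rightarrow> nat \<Rightarrow> 'v \<Rightarrow> real" where
  "mpc_load thr i t v =
     real machines * (\<Sum>u\<in>nbrs v. if i u = i v then mx thr i t {u, v} else 0)"

text \<open>Agreement is demanded in all rounds up to \<open>t\<close>, since the value of an edge
  depends on the whole activity history of its endpoints.\<close>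

definition good :: "('v \<times> nat \<Rightarrow> real) \<Rightarrow> ('v \<Rightarrow> nat) \<Rightarrow> nat \<Rightarrow> 'v \<Rightarrow> bool" where
  "good thr i t v \<longleftrightarrow> (\<forall>s\<le>t. v \<in> sa thr s \<longleftrightarrow> v \<in> ma thr i s)"

text \<open>The closeness condition keeps the probability of the event small whatever happened before, so
  that no conditioning on earlier rounds is needed.\<close>
definition flips :: "real \<Rightarrow> ('v \<times> nat \<Rightarrow> real) \<Rightarrow> ('v \<Rightarrow> nat) \<Rightarrow> nat \<Rightarrow> 'v \<Rightarrow> bool" where
  "flips \<delta> thr i t u \<longleftrightarrow> \<bar>seq_load thr t u - mpc_load thr i t u\<bar> \<le> \<delta> * b u \<and>
     (seq_load thr t u \<le> thr (u, Suc t)) \<noteq> (mpc_load thr i t u \<le> thr (u, Suc t))"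

text \<open>The sequential value is an adequate weight: it equals the other process's value whenever
  both endpoints have agreed up to round \<open>t\<close>.\<close>

definition flip_weight :: "real \<Rightarrow> ('v \<times> nat \<Rightarrow> real) \<Rightarrow> ('v \<Rightarrow> nat) \<Rightarrow> nat \<Rightarrow> 'v \<Rightarrow> real" where
  "flip_weight \<delta> thr i t v =
     real machines * (\<Sum>u\<in>nbrs v. if i u = i v \<and> flips \<delta> thr i t u then sx thr t {u, v} else 0)"

text \<open>Weighting with the larger of the two values, rather than with their difference, makes the
  weight of an edge at most double per round.\<close>
definition bad_weight :: "('v \<times> nat \<Rightarrow> real) \<Rightarrow> ('v \<Rightarrow> nat) \<Rightarrow> nat \<Rightarrow> 'v \<Rightarrow> real" where
  "bad_weight thr i t v = real machines *
     (\<Sum>u\<in>nbrs v. if i u = i v \<and> \<not> good thr i t u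
        then max (sx thr t {u, v}) (mx thr i t {u, v}) else 0)"

section \<open>Graph structure and one-round recursions of the active sets\<close>

lemma finite_V: "finite V"
  using graph by (simp add: simple_graph_def)

lemma machines_pos: "machines > 0"
  using avg_degree_pos by (simp add: num_machines_def)

lemma edgeD:
  assumes "{u, v} \<in> E"
  shows "u \<in> V" "v \<in> V" "u \<noteq> v"
proof -
  obtain x y where xy: "{u, v} = {x, y}" "x \<in> V" "y \<in> V" "x \<noteq> y"
    using assms graph unfolding simple_graph_def by blast
  show "u \<in> V" "v \<in> V" "u \<noteq> v" using xy by (auto simp: doubleton_eq_iff)
qed

lemma nbrs_subset: "nbrs v \<subseteq> V - {v}"
  unfolding nbrs_def using edgeD by blast

lemma incident_edges_eq: "incident_edges E v = (\<lambda>u. {u, v}) ` nbrs v"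
proof (intro set_eqI iffI)
  fix e assume "e \<in> incident_edges E v"
  then have e: "e \<in> E" "v \<in> e" by (auto simp: incident_edges_def)
  then obtain x y where "e = {x, y}" using graph unfolding simple_graph_def by blast
  with e(2) have "\<exists>u. e = {u, v}" by blast
  then show "e \<in> (\<lambda>u. {u, v}) ` nbrs v" using e(1) by (auto simp: nbrs_def)
qed (auto simp: incident_edges_def nbrs_def)

lemma sum_incident: "(\<Sum>e\<in>incident_edges E v. f e) = (\<Sum>u\<in>nbrs v. f {u, v})"
  unfolding incident_edges_eq
  by (rule sum.reindex_cong[OF _ refl refl]) (auto simp: inj_on_def doubleton_eq_iff)

lemma card_incident: "card (incident_edges E v) = card (nbrs v)"
  unfolding incident_edges_eq by (rule card_image) (auto simp: inj_on_def doubleton_eq_iff)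

lemma sum_local: "(\<Sum>e\<in>local_edges E i v. f e) = (\<Sum>u\<in>nbrs v. if i u = i v then f {u, v} else 0)"
  unfolding sum_local_edges[OF graph] sum_incident by (intro sum.cong) auto

lemma seq_active_Suc_iff:
  "v \<in> sa thr (Suc t) \<longleftrightarrow> v \<in> sa thr t \<and> seq_load thr t v \<le> thr (v, Suc t)"
  by (simp add: sum_incident seq_load_def)

lemma mpc_active_Suc_iff:
  "v \<in> ma thr i (Suc t) \<longleftrightarrow> v \<in> ma thr i t \<and> mpc_load thr i t v \<le> thr (v, Suc t)"
  by (simp add: sum_local mpc_load_def)

section \<open>Nonnegativity and growth of the edge values\<close>

lemma vertex_cap_nonneg: "v \<in> V \<Longrightarrow> vertex_cap V E b v \<ge> 0"
  using b_nonneg avg_degree_pos by (auto simp: vertex_cap_def intro!: divide_nonneg_nonneg)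

lemma init_nonneg:
  assumes "e \<in> E"
  shows "init_value V E b r e \<ge> 0"
proof -
  have "finite e" "e \<subseteq> V" "e \<noteq> {}"
    using graph assms simple_graph_edgeD[OF graph assms] by (auto simp: simple_graph_def)
  then show ?thesis
    using r_nonneg[OF assms] vertex_cap_nonneg by (auto simp: init_value_def)
qed

lemma init_le_cap:
  assumes "e \<in> E" "v \<in> e"
  shows "init_value V E b r e \<le> vertex_cap V E b v"
  using simple_graph_edgeD[OF graph assms(1)] assms(2)
  by (auto simp: init_value_def intro!: min.coboundedI2 Min_le)

lemma seq_value_nonneg: "e \<in> E \<Longrightarrow> sx thr t e \<ge> 0"
  by (induction t) (auto simp: init_nonneg)

lemma mpc_value_nonneg: "e \<in> E \<Longrightarrow> mx thr i t e \<ge> 0"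
  by (induction t) (auto simp: init_nonneg)

lemma seq_value_Suc_le: "e \<in> E \<Longrightarrow> sx thr (Suc t) e \<le> 2 * sx thr t e"
  using seq_value_nonneg[of e thr t] by simp

lemma mpc_value_Suc_le: "e \<in> E \<Longrightarrow> mx thr i (Suc t) e \<le> 2 * mx thr i t e"
  using mpc_value_nonneg[of e thr i t] by simp

lemma seq_value_le:
  assumes "e \<in> E" "v \<in> e"
  shows "sx thr t e \<le> 2 ^ t * vertex_cap V E b v"
proof (induction t)
  case 0
  then show ?case using init_le_cap[OF assms] by simp
next
  case (Suc t)
  then show ?case using seq_value_Suc_le[OF assms(1), of thr t] by simp
qed

text \<open>Initially at most \<open>card (nbrs v)\<close> edges carry at most
  \<open>vertex_cap\<close> each, and every round at most doubles them. This crude bound serves to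
  control the second moment in the sampling estimate.\<close>

lemma seq_load_le:
  assumes "v \<in> V"
  shows "seq_load thr t v \<le> 2 ^ t * (0.8 * b v)"
proof -
  have "seq_load thr t v \<le> (\<Sum>u\<in>nbrs v. 2 ^ t * vertex_cap V E b v)"
    unfolding seq_load_def by (intro sum_mono seq_value_le) (auto simp: nbrs_def)
  also have "\<dots> = 2 ^ t * (real (card (incident_edges E v)) * vertex_cap V E b v)"
    by (simp add: card_incident)
  also have "real (card (incident_edges E v)) * vertex_cap V E b v \<le> 0.8 * b v"
  proof -
    define d where "d = max (real (card (incident_edges E v))) (avg_degree V E)"
    have d: "d > 0" "real (card (incident_edges E v)) \<le> d"
      using avg_degree_pos by (auto simp: d_def)
    then have "real (card (incident_edges E v)) * (0.8 * b v) \<le> d * (0.8 * b v)"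
      using b_nonneg[OF assms] by (intro mult_right_mono) auto
    then show ?thesis using d by (simp add: vertex_cap_def d_def[symmetric] field_simps)
  qed
  finally show ?thesis by simp
qed

text \<open>Whether an edge doubles is decided by the activity of its own endpoints and its current
  value alone, so divergence elsewhere in the graph cannot affect it directly.\<close>

lemma values_agree:
  assumes "\<And>u. u \<in> e \<Longrightarrow> good thr i t u"
  shows "sx thr t e = mx thr i t e"
  using assms
proof (induction t)
  case (Suc t)
  have "sx thr t e = mx thr i t e" using Suc by (auto simp: good_def)
  moreover have "e \<subseteq> sa thr (Suc t) \<longleftrightarrow> e \<subseteq> ma thr i (Suc t)"
    using Suc.prems unfolding good_def by (meson order_refl subset_iff)
  ultimately show ?case by (simp del: seq_active.simps mpc_active.simps)
qed simp

lemma good_mono: "good thr i t v \<Longrightarrow> s \<le> t \<Longrightarrow> good thr i s v"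
  by (auto simp: good_def)

lemma good_0: "good thr i 0 v"
  by (simp add: good_def)

text \<open>Local edges to neighbours that have always agreed cancel. On the others both values are
  nonnegative, so their difference is at most their maximum.\<close>

lemma load_diff_le_bad_weight:
  assumes "good thr i t v"
  shows "\<bar>mpc_load thr i t v - sampled_load thr i t v\<bar> \<le> bad_weight thr i t v"
proof -
  have "\<bar>mpc_load thr i t v - sampled_load thr i t v\<bar> = real machines *
     \<bar>\<Sum>u\<in>nbrs v. (if i u = i v then mx thr i t {u, v} else 0) - (if i u = i v then sx thr t {u, v}
       else 0)\<bar>"
    unfolding mpc_load_def sampled_load_def sum_subtractf right_diff_distrib[symmetric] abs_mult
      by simp
  also have "\<dots> \<le> bad_weight thr i t v"
    unfolding bad_weight_def
  proof (intro mult_left_mono order.trans[OF sum_abs] sum_mono)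
    fix u assume u: "u \<in> nbrs v"
    then have e: "{u, v} \<in> E" by (simp add: nbrs_def)
    have "sx thr t {u, v} = mx thr i t {u, v}" if "good thr i t u"
      using that assms by (intro values_agree) auto
    then show "\<bar>(if i u = i v then mx thr i t {u, v} else 0) - (if i u = i v then sx thr t {u, v}
      else 0)\<bar>
      \<le> (if i u = i v \<and> \<not> good thr i t u then max (sx thr t {u, v}) (mx thr i t {u, v}) else 0)"
      using seq_value_nonneg[OF e, of thr t] mpc_value_nonneg[OF e, of thr i t] by auto
  qed simp
  finally show ?thesis .
qed

text \<open>A first disagreement after round \<open>t\<close> requires both processes to have
  \<open>u\<close> active at \<open>t\<close>, so the fresh threshold must lie between the two
  loads.\<close>

lemma newly_bad_flips:
  assumes "good thr i t u" "\<not> good thr i (Suc t) u"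
    and close: "u \<in> sa thr t \<Longrightarrow> \<bar>seq_load thr t u - mpc_load thr i t u\<bar> \<le> \<delta> * b u"
  shows "flips \<delta> thr i t u"
proof -
  have neq: "(u \<in> sa thr (Suc t)) \<noteq> (u \<in> ma thr i (Suc t))"
    using assms(1,2) unfolding good_def by (metis le_Suc_eq)
  have same: "u \<in> sa thr t \<longleftrightarrow> u \<in> ma thr i t" using assms(1) by (auto simp: good_def)
  with neq have act: "u \<in> sa thr t" unfolding seq_active_Suc_iff mpc_active_Suc_iff by blast
  with neq same close show ?thesis
    unfolding flips_def seq_active_Suc_iff mpc_active_Suc_iff by blast
qed

text \<open>Neighbours that were bad before at most double their weight. A newly bad neighbour must
  flip, and it still had equal values in round \<open>t\<close>, which also at most double.\<close>

lemma bad_weight_Suc_le: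
  assumes v: "good thr i (Suc t) v"
    and close: "\<And>u. u \<in> V \<Longrightarrow> good thr i t u \<Longrightarrow> u \<in> sa thr t \<Longrightarrow>
      \<bar>seq_load thr t u - mpc_load thr i t u\<bar> \<le> \<delta> * b u"
  shows "bad_weight thr i (Suc t) v \<le> 2 * bad_weight thr i t v + 2 * flip_weight \<delta> thr i t v"
proof -
  have "(\<Sum>u\<in>nbrs v. if i u = i v \<and> \<not> good thr i (Suc t) u
          then max (sx thr (Suc t) {u, v}) (mx thr i (Suc t) {u, v}) else 0)
     \<le> (\<Sum>u\<in>nbrs v. 2 * (if i u = i v \<and> \<not> good thr i t u
          then max (sx thr t {u, v}) (mx thr i t {u, v}) else 0)
        + 2 * (if i u = i v \<and> flips \<delta> thr i t u then sx thr t {u, v} else 0))"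
  proof (rule sum_mono)
    fix u assume u: "u \<in> nbrs v"
    then have e: "{u, v} \<in> E" by (simp add: nbrs_def)
    have uV: "u \<in> V" using u nbrs_subset by auto
    note nn = seq_value_nonneg[OF e, of thr t] mpc_value_nonneg[OF e, of thr i t]
    note dbl = seq_value_Suc_le[OF e, of thr t] mpc_value_Suc_le[OF e, of thr i t]
    define M where "M = max (sx thr (Suc t) {u, v}) (mx thr i (Suc t) {u, v})"
    have M: "M \<le> 2 * max (sx thr t {u, v}) (mx thr i t {u, v})"
      using dbl unfolding M_def by linarith
    have "M \<le> 2 * sx thr t {u, v} \<and> flips \<delta> thr i t u"
      if "good thr i t u" "\<not> good thr i (Suc t) u"
    proof -
      have "sx thr t {u, v} = mx thr i t {u, v}"
        using that(1) good_mono[OF v] by (intro values_agree) auto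
      with M newly_bad_flips[OF that close[OF uV that(1)]] show ?thesis by auto
    qed
    with M nn show "(if i u = i v \<and> \<not> good thr i (Suc t) u
          then max (sx thr (Suc t) {u, v}) (mx thr i (Suc t) {u, v}) else 0)
     \<le> 2 * (if i u = i v \<and> \<not> good thr i t u then max (sx thr t {u, v}) (mx thr i t {u, v}) else 0)
        + 2 * (if i u = i v \<and> flips \<delta> thr i t u then sx thr t {u, v} else 0)"
      unfolding M_def[symmetric] by auto
  qed
  then have "bad_weight thr i (Suc t) v \<le> real machines * (\<Sum>u\<in>nbrs v. 2 * (if i u = i v \<and> \<not> good
    thr i t u
          then max (sx thr t {u, v}) (mx thr i t {u, v}) else 0)
        + 2 * (if i u = i v \<and> flips \<delta> thr i t u then sx thr t {u, v} else 0))"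
    unfolding bad_weight_def by (intro mult_left_mono) auto
  also have "\<dots> = 2 * bad_weight thr i t v + 2 * flip_weight \<delta> thr i t v"
    unfolding bad_weight_def flip_weight_def sum.distrib sum_distrib_left[symmetric]
    by (simp add: algebra_simps)
  finally show ?thesis .
qed

section \<open>Deterministic error recursion outside the failure events\<close>

definition sample_fails :: "real \<Rightarrow> ('v \<times> nat \<Rightarrow> real) \<Rightarrow> ('v \<Rightarrow> nat) \<Rightarrow> nat \<Rightarrow> 'v \<Rightarrow> bool" where
  "sample_fails \<epsilon> thr i t v \<longleftrightarrow> \<bar>sampled_load thr i t v - seq_load thr t v\<bar> > \<epsilon> * b v"

text \<open>The factor 10 is twice the bound 5 on the flip probability per unit of closeness; the
  doubling pays for the second-order term in Chernoff. The summand \<open>\<epsilon> * b v\<close>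
  is the allowed deviation.\<close>

definition flip_fails :: "real \<Rightarrow> ('v \<times> nat \<Rightarrow> real) \<Rightarrow> ('v \<Rightarrow> nat) \<Rightarrow> nat \<Rightarrow> 'v \<Rightarrow> bool" where
  "flip_fails \<epsilon> thr i t v \<longleftrightarrow>
     flip_weight (13 ^ t * \<epsilon>) thr i t v > 10 * (13 ^ t * \<epsilon>) * sampled_load thr i t v + \<epsilon> * b v"

text \<open>The induction closes because closeness of the loads in round \<open>t\<close> follows
  from the bound for round \<open>t\<close>, and an active vertex has sampled load at most half of
  \<open>b v\<close>, which turns the factor 10 in \<open>flip_fails\<close> into 5.\<close>

lemma bad_weight_le:
  assumes eps: "0 \<le> \<epsilon>" "\<epsilon> \<le> 0.1"
    and thr: "\<And>s u. u \<in> V \<Longrightarrow> s < t \<Longrightarrow> thr (u, Suc s) \<le> 0.4 * b u"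
    and ok: "\<And>s u. u \<in> V \<Longrightarrow> s < t \<Longrightarrow> \<not> sample_fails \<epsilon> thr i s u \<and> \<not> flip_fails \<epsilon> thr i s u"
    and v: "v \<in> V" "good thr i t v" "v \<in> sa thr t"
  shows "bad_weight thr i t v \<le> (13 ^ t - 1) * \<epsilon> * b v"
  using thr ok v
proof (induction t arbitrary: v)
  case 0
  then show ?case by (simp add: bad_weight_def good_0)
next
  case (Suc t)
  have close: "\<bar>seq_load thr t u - mpc_load thr i t u\<bar> \<le> 13 ^ t * \<epsilon> * b u"
    if u: "u \<in> V" "good thr i t u" "u \<in> sa thr t" for u
  proof -
    have "bad_weight thr i t u \<le> (13 ^ t - 1) * \<epsilon> * b u"
      using Suc.prems u by (intro Suc.IH) auto
    moreover have "\<bar>sampled_load thr i t u - seq_load thr t u\<bar> \<le> \<epsilon> * b u"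
      using Suc.prems(2)[of u t] u by (auto simp: sample_fails_def)
    ultimately show ?thesis
      using load_diff_le_bad_weight[OF u(2)] by (simp add: algebra_simps)
  qed
  have act: "v \<in> sa thr t" "seq_load thr t v \<le> thr (v, Suc t)"
    using Suc.prems(5) unfolding seq_active_Suc_iff by auto
  have gt: "good thr i t v" using good_mono[OF Suc.prems(4)] by simp
  have bv: "b v \<ge> 0" using b_nonneg Suc.prems by simp
  have "\<epsilon> * b v \<le> 0.1 * b v" using eps bv by (intro mult_right_mono) auto
  moreover have "\<bar>sampled_load thr i t v - seq_load thr t v\<bar> \<le> \<epsilon> * b v"
    using Suc.prems(2)[of v t] Suc.prems(3) by (auto simp: sample_fails_def)
  moreover have "thr (v, Suc t) \<le> 0.4 * b v" using Suc.prems(1)[of v t] Suc.prems(3) by simp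
  ultimately have S: "sampled_load thr i t v \<le> 0.5 * b v" using act by linarith
  have "flip_weight (13 ^ t * \<epsilon>) thr i t v \<le> 10 * (13 ^ t * \<epsilon>) * sampled_load thr i t v + \<epsilon> * b v"
    using Suc.prems(2)[of v t] Suc.prems(3) by (auto simp: flip_fails_def)
  also have "10 * (13 ^ t * \<epsilon>) * sampled_load thr i t v \<le> 10 * (13 ^ t * \<epsilon>) * (0.5 * b v)"
    using S eps by (intro mult_left_mono) auto
  finally have F: "flip_weight (13 ^ t * \<epsilon>) thr i t v \<le> 5 * (13 ^ t * \<epsilon> * b v) + \<epsilon> * b v"
    by (simp add: mult_ac)
  have B: "bad_weight thr i t v \<le> (13 ^ t - 1) * \<epsilon> * b v"
    using Suc.prems gt act by (intro Suc.IH) auto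
  \<comment> \<open>In units of \<open>\<epsilon> * b v\<close> the recursion gives
    \<open>2 * (13 ^ t - 1) + 2 * (5 * 13 ^ t + 1) = 12 * 13 ^ t\<close>, and this is at most
    \<open>13 ^ Suc t - 1\<close> because \<open>13 ^ t\<close> is at least 1.\<close>
  have "\<epsilon> * b v \<le> 13 ^ t * (\<epsilon> * b v)"
    using eps bv mult_right_mono[of 1 "13 ^ t" "\<epsilon> * b v"] by simp
  with bad_weight_Suc_le[OF Suc.prems(4) close] F B show ?case
    by (simp add: algebra_simps)
qed

text \<open>The \<open>- 1\<close> in the bound on the bad weight leaves room for exactly the
  sampling error of round \<open>t\<close>.\<close>

lemma load_diff_le:
  assumes "0 \<le> \<epsilon>" "\<epsilon> \<le> 0.1"
    and "\<And>s u. u \<in> V \<Longrightarrow> s \<le> t \<Longrightarrow> thr (u, Suc s) \<le> 0.4 * b u"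
    and ok: "\<And>s u. u \<in> V \<Longrightarrow> s \<le> t \<Longrightarrow> \<not> sample_fails \<epsilon> thr i s u \<and> \<not> flip_fails \<epsilon> thr i s u"
    and v: "v \<in> V" "good thr i t v" "v \<in> sa thr t"
  shows "\<bar>seq_load thr t v - mpc_load thr i t v\<bar> \<le> 13 ^ t * \<epsilon> * b v"
proof -
  have "bad_weight thr i t v \<le> (13 ^ t - 1) * \<epsilon> * b v"
    using assms by (intro bad_weight_le) auto
  moreover have "\<bar>sampled_load thr i t v - seq_load thr t v\<bar> \<le> \<epsilon> * b v"
    using ok[of v t] v by (auto simp: sample_fails_def)
  ultimately show ?thesis
    using load_diff_le_bad_weight[OF v(2)] by (simp add: algebra_simps)
qed

text \<open>The last round before the first disagreement provides \<open>s\<close>. This reduces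
  divergence to events \<open>flips\<close>, whose probability can be bounded without conditioning
  on the past.\<close>

lemma bad_imp_flips:
  assumes eps: "0 \<le> \<epsilon>" "\<epsilon> \<le> 0.1"
    and thr: "\<And>s u. u \<in> V \<Longrightarrow> s < t \<Longrightarrow> thr (u, Suc s) \<le> 0.4 * b u"
    and ok: "\<And>s u. u \<in> V \<Longrightarrow> s < t \<Longrightarrow> \<not> sample_fails \<epsilon> thr i s u \<and> \<not> flip_fails \<epsilon> thr i s u"
    and v: "v \<in> V" "\<not> good thr i t v"
  shows "\<exists>s<t. flips (13 ^ s * \<epsilon>) thr i s v"
  using thr ok v
proof (induction t)
  case 0
  then show ?case by (simp add: good_0)
next
  case (Suc t)
  show ?case
  proof (cases "good thr i t v")
    case True
    have "flips (13 ^ t * \<epsilon>) thr i t v"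
    proof (rule newly_bad_flips[OF True Suc.prems(4)])
      assume "v \<in> sa thr t"
      then show "\<bar>seq_load thr t v - mpc_load thr i t v\<bar> \<le> 13 ^ t * \<epsilon> * b v"
        using Suc.prems True eps by (intro load_diff_le) auto
    qed
    then show ?thesis by blast
  next
    case False
    then show ?thesis using Suc.IH Suc.prems less_Suc_eq by auto
  qed
qed

section \<open>Dependence on the thresholds and measurability\<close>

abbreviation "thrM \<equiv> (\<lambda>p :: 'v \<times> nat. uniform_interval (0.2 * b (fst p)) (0.4 * b (fst p)))"
abbreviation "macM \<equiv> (\<lambda>v :: 'v. uniform_count_measure {1..machines})"
abbreviation "coup \<equiv> coupling V E b"

lemma coupling_eq: "coup = Pi\<^sub>M (V \<times> {1..rounds}) thrM \<Otimes>\<^sub>M Pi\<^sub>M V macM"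
  by (simp add: coupling_def)

lemma prob_space_thrM: "prob_space (thrM p)"
  by (rule prob_space_uniform_interval)

lemma prob_space_macM: "prob_space (macM v)"
  using machines_pos by (intro prob_space_uniform_count_measure) auto

lemmas prob_space_thrs = prob_space_PiM[of "V \<times> {1..rounds}" thrM, OF prob_space_thrM]
lemmas prob_space_macs = prob_space_PiM[of V macM, OF prob_space_macM]

text \<open>The state after \<open>t\<close> rounds reads only the thresholds of rounds 1 to
  \<open>t\<close>. Hence the thresholds of round \<open>Suc t\<close> are fresh randomness.\<close>

lemma seq_cong:
  assumes "\<And>u s. u \<in> V \<Longrightarrow> s \<in> {1..t} \<Longrightarrow> thr (u, s) = thr' (u, s)"
  shows "sa thr t = sa thr' t \<and> sx thr t = sx thr' t"
  using assms
proof (induction t)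
  case 0
  then show ?case by (simp add: fun_eq_iff)
next
  case (Suc t)
  have sub: "sa thr t \<subseteq> V" for thr t by (induction t) auto
  have IH: "sa thr t = sa thr' t" "sx thr t = sx thr' t" using Suc by auto
  then have A: "sa thr (Suc t) = sa thr' (Suc t)"
    using sub[of thr' t] Suc.prems[of _ "Suc t"] by auto
  show ?case using A IH by (simp add: fun_eq_iff del: seq_active.simps)
qed

lemma mpc_cong:
  assumes "\<And>u s. u \<in> V \<Longrightarrow> s \<in> {1..t} \<Longrightarrow> thr (u, s) = thr' (u, s)"
  shows "ma thr i t = ma thr' i t \<and> mx thr i t = mx thr' i t"
  using assms
proof (induction t)
  case 0
  then show ?case by (simp add: fun_eq_iff)
next
  case (Suc t)
  have sub: "ma thr i t \<subseteq> V" for thr t by (induction t) auto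
  have IH: "ma thr i t = ma thr' i t" "mx thr i t = mx thr' i t" using Suc by auto
  then have A: "ma thr i (Suc t) = ma thr' i (Suc t)"
    using sub[of thr' t] Suc.prems[of _ "Suc t"] by auto
  show ?case using A IH by (simp add: fun_eq_iff del: mpc_active.simps)
qed

text \<open>The threshold values on which exactly one of the two tests succeeds: half-open, as the
  tests use \<le>. Unlike \<open>flips\<close>, this set does not read the thresholds of round
  \<open>Suc t\<close>, so it stays fixed while they are resampled.\<close>

definition gap :: "real \<Rightarrow> ('v \<times> nat \<Rightarrow> real) \<Rightarrow> ('v \<Rightarrow> nat) \<Rightarrow> nat \<Rightarrow> 'v \<Rightarrow> real set" where
  "gap \<delta> thr i t u = (if \<bar>seq_load thr t u - mpc_load thr i t u\<bar> \<le> \<delta> * b u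
     then {min (seq_load thr t u) (mpc_load thr i t u)..<max (seq_load thr t u) (mpc_load thr i t
       u)}
     else {})"

lemma flips_iff_gap: "flips \<delta> thr i t u \<longleftrightarrow> thr (u, Suc t) \<in> gap \<delta> thr i t u"
  by (auto simp: flips_def gap_def)

lemma loads_cong:
  assumes "\<And>u s. u \<in> V \<Longrightarrow> s \<in> {1..t} \<Longrightarrow> thr (u, s) = thr' (u, s)"
  shows "sx thr t = sx thr' t" "gap \<delta> thr i t = gap \<delta> thr' i t"
    "sampled_load thr i t = sampled_load thr' i t"
proof -
  have "sx thr t = sx thr' t" "mx thr i t = mx thr' i t"
    using seq_cong[of t thr thr'] mpc_cong[of t thr thr' i] assms by auto
  then show "sx thr t = sx thr' t" "gap \<delta> thr i t = gap \<delta> thr' i t"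
    "sampled_load thr i t = sampled_load thr' i t"
    by (simp_all add: gap_def[abs_def] seq_load_def[abs_def] mpc_load_def[abs_def]
      sampled_load_def[abs_def] cong: if_cong)
qed

text \<open>An interval of length at most \<open>\<delta> * b u\<close> is hit by a uniform variable
  on a range of length \<open>0.2 * b u\<close>.\<close>

lemma emeasure_gap_le:
  assumes "u \<in> V" "\<delta> \<ge> 0"
  shows "emeasure (thrM (u, s)) (gap \<delta> thr i t u) \<le> ennreal (5 * \<delta>)"
proof (cases "\<bar>seq_load thr t u - mpc_load thr i t u\<bar> \<le> \<delta> * b u")
  case True
  define x where "x = min (seq_load thr t u) (mpc_load thr i t u)"
  define y where "y = max (seq_load thr t u) (mpc_load thr i t u)"
  have xy: "x \<le> y" "y - x \<le> \<delta> * b u" using True by (auto simp: x_def y_def)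
  have g: "gap \<delta> thr i t u = {x..<y}" using True by (simp add: gap_def x_def y_def)
  show ?thesis
  \<comment> \<open>Here the threshold is a point mass, but closeness forces equal loads and the gap
    is empty.\<close>
  proof (cases "b u = 0")
    case True
    then show ?thesis using xy g by simp
  next
    case False
    then have b: "b u > 0" using b_nonneg[OF assms(1)] by simp
    then have "emeasure (thrM (u, s)) (gap \<delta> thr i t u) \<le> ennreal ((y - x) / (0.4 * b u - 0.2 * b
      u))"
      unfolding g fst_conv using xy by (intro emeasure_uniform_interval_le) auto
    also have "\<dots> \<le> ennreal (5 * \<delta>)"
      using xy b by (intro ennreal_leI) (simp add: field_simps)
    finally show ?thesis .
  qed
qed (simp add: gap_def)

lemma measurable_gap: "gap \<delta> thr i t u \<in> sets borel"
  by (simp add: gap_def)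

section \<open>Measurability of the loads and of the failure events\<close>

lemma measurable_seq_value:
  "t \<le> rounds \<Longrightarrow> e \<in> E \<Longrightarrow> (\<lambda>\<omega>. sx (fst \<omega>) t e) \<in> borel_measurable coup"
  using measurable_seq[OF graph] by blast

lemma measurable_mpc_value:
  "t \<le> rounds \<Longrightarrow> e \<in> E \<Longrightarrow> (\<lambda>\<omega>. mx (fst \<omega>) (snd \<omega>) t e) \<in> borel_measurable coup"
  using measurable_mpc[OF graph] by blast

lemma measurable_same_machine:
  assumes "u \<in> V" "v \<in> V"
  shows "Measurable.pred coup (\<lambda>\<omega>. snd \<omega> u = snd \<omega> v)"
proof -
  have [measurable]: "(\<lambda>\<omega>. real (snd \<omega> u)) \<in> borel_measurable coup"
    "(\<lambda>\<omega>. real (snd \<omega> v)) \<in> borel_measurable coup"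
    using assms by (auto intro!: measurable_compose[OF measurable_coupling_machine])
  have "Measurable.pred coup (\<lambda>\<omega>. real (snd \<omega> u) = real (snd \<omega> v))"
    by measurable
  then show ?thesis by simp
qed

lemma measurable_seq_load:
  "t \<le> rounds \<Longrightarrow> (\<lambda>\<omega>. seq_load (fst \<omega>) t v) \<in> borel_measurable coup"
  unfolding seq_load_def by (intro borel_measurable_sum measurable_seq_value) (auto simp: nbrs_def)

lemma measurable_local_sum:
  assumes v: "v \<in> V" and f: "\<And>u. u \<in> nbrs v \<Longrightarrow> f u \<in> borel_measurable coup"
    and P: "\<And>u. u \<in> nbrs v \<Longrightarrow> Measurable.pred coup (P u)"
  shows "(\<lambda>\<omega>. real machines * (\<Sum>u\<in>nbrs v. if snd \<omega> u = snd \<omega> v \<and> P u \<omega> then f u \<omega> else 0))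
    \<in> borel_measurable coup"
proof (intro borel_measurable_times borel_measurable_const borel_measurable_sum)
  fix u assume u: "u \<in> nbrs v"
  then have [measurable]: "Measurable.pred coup (\<lambda>\<omega>. snd \<omega> u = snd \<omega> v)"
    using nbrs_subset v by (intro measurable_same_machine) auto
  note f[OF u, measurable] P[OF u, measurable]
  show "(\<lambda>\<omega>. if snd \<omega> u = snd \<omega> v \<and> P u \<omega> then f u \<omega> else 0) \<in> borel_measurable coup"
    by measurable
qed

lemma measurable_sampled_load:
  assumes "t \<le> rounds" "v \<in> V"
  shows "(\<lambda>\<omega>. sampled_load (fst \<omega>) (snd \<omega>) t v) \<in> borel_measurable coup"
  using measurable_local_sum[of v "\<lambda>u \<omega>. sx (fst \<omega>) t {u, v}" "\<lambda>u \<omega>. True"] assms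
    measurable_seq_value[OF assms(1)]
  by (simp add: sampled_load_def nbrs_def)

lemma measurable_mpc_load:
  assumes "t \<le> rounds" "v \<in> V"
  shows "(\<lambda>\<omega>. mpc_load (fst \<omega>) (snd \<omega>) t v) \<in> borel_measurable coup"
  using measurable_local_sum[of v "\<lambda>u \<omega>. mx (fst \<omega>) (snd \<omega>) t {u, v}" "\<lambda>u \<omega>. True"] assms
    measurable_mpc_value[OF assms(1)]
  by (simp add: mpc_load_def nbrs_def)

lemma measurable_flips:
  assumes "t < rounds" "u \<in> V"
  shows "Measurable.pred coup (\<lambda>\<omega>. flips \<delta> (fst \<omega>) (snd \<omega>) t u)"
proof -
  have [measurable]: "(\<lambda>\<omega>. seq_load (fst \<omega>) t u) \<in> borel_measurable coup"
    "(\<lambda>\<omega>. mpc_load (fst \<omega>) (snd \<omega>) t u) \<in> borel_measurable coup"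
    "(\<lambda>\<omega>. fst \<omega> (u, Suc t)) \<in> borel_measurable coup"
    using assms by (auto intro!: measurable_seq_load measurable_mpc_load measurable_coupling_thr)
  show ?thesis unfolding flips_def by measurable
qed

lemma measurable_flip_weight:
  assumes "t < rounds" "v \<in> V"
  shows "(\<lambda>\<omega>. flip_weight \<delta> (fst \<omega>) (snd \<omega>) t v) \<in> borel_measurable coup"
  unfolding flip_weight_def using assms nbrs_subset[of v]
  by (intro measurable_local_sum measurable_seq_value measurable_flips) (auto simp: nbrs_def)

lemma sample_fails_sets:
  assumes "t \<le> rounds" "v \<in> V"
  shows "{\<omega> \<in> space coup. sample_fails \<epsilon> (fst \<omega>) (snd \<omega>) t v} \<in> sets coup"
proof -
  note [measurable] = measurable_seq_load[OF assms(1), of v] measurable_sampled_load[OF assms]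
  show ?thesis unfolding sample_fails_def by measurable
qed

lemma flip_fails_sets:
  assumes "t < rounds" "v \<in> V"
  shows "{\<omega> \<in> space coup. flip_fails \<epsilon> (fst \<omega>) (snd \<omega>) t v} \<in> sets coup"
proof -
  note [measurable] = measurable_flip_weight[OF assms] measurable_sampled_load[OF less_imp_le[OF
    assms(1)] assms(2)]
  show ?thesis unfolding flip_fails_def by measurable
qed

lemma flips_sets:
  assumes "t < rounds" "v \<in> V"
  shows "{\<omega> \<in> space coup. flips \<delta> (fst \<omega>) (snd \<omega>) t v} \<in> sets coup"
  using measurable_flips[OF assms] by measurable

text \<open>The machines \<open>i\<close> and the thresholds \<open>x\<close> of all other rounds
  are frozen, including those of later rounds; only the thresholds of round \<open>Suc t\<close>
  stay random.\<close>

lemma emeasure_coupling_le_step: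
  assumes t: "t < rounds" and S: "S \<in> sets coup"
    and le: "\<And>x i. emeasure (Pi\<^sub>M (V \<times> {Suc t}) thrM) {y \<in> space (Pi\<^sub>M (V \<times> {Suc t}) thrM).
       (merge (V \<times> ({1..rounds} - {Suc t})) (V \<times> {Suc t}) (x, y), i) \<in> S} \<le> c"
  shows "emeasure coup S \<le> c"
  unfolding coupling_eq
proof (rule emeasure_pair_le_slice2[OF prob_space_thrs prob_space_macs])
  show S': "S \<in> sets (Pi\<^sub>M (V \<times> {1..rounds}) thrM \<Otimes>\<^sub>M Pi\<^sub>M V macM)"
    using S by (simp add: coupling_eq)
  fix i assume i: "i \<in> space (Pi\<^sub>M V macM)"
  let ?I = "V \<times> ({1..rounds} - {Suc t})" and ?J = "V \<times> {Suc t}"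
  have U: "V \<times> {1..rounds} = ?I \<union> ?J" using t by auto
  let ?S = "{thr \<in> space (Pi\<^sub>M (V \<times> {1..rounds}) thrM). (thr, i) \<in> S}"
  show "emeasure (Pi\<^sub>M (V \<times> {1..rounds}) thrM) ?S \<le> c"
    unfolding U
  proof (rule emeasure_PiM_le_slice[OF prob_space_thrM])
    have "?S = (\<lambda>x. (x, i)) -` S"
      using sets.sets_into_space[OF S'] by (auto simp: space_pair_measure)
    also have "\<dots> \<in> sets (Pi\<^sub>M (V \<times> {1..rounds}) thrM)" by (rule sets_Pair2[OF S'])
    finally show "{thr \<in> space (Pi\<^sub>M (?I \<union> ?J) thrM). (thr, i) \<in> S} \<in> sets (Pi\<^sub>M (?I \<union> ?J) thrM)"
      unfolding U .
    fix x
    have "emeasure (Pi\<^sub>M ?J thrM) {y \<in> space (Pi\<^sub>M ?J thrM). merge ?I ?J (x, y) \<in>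
            {thr \<in> space (Pi\<^sub>M (?I \<union> ?J) thrM). (thr, i) \<in> S}}
        \<le> emeasure (Pi\<^sub>M ?J thrM) {y \<in> space (Pi\<^sub>M ?J thrM). (merge ?I ?J (x, y), i) \<in> S}"
      if "x \<in> space (Pi\<^sub>M ?I thrM)"
    proof (rule emeasure_mono)
      have "{y \<in> space (Pi\<^sub>M ?J thrM). (merge ?I ?J (x, y), i) \<in> S} =
        {y \<in> space (Pi\<^sub>M ?J thrM). merge ?I ?J (x, y) \<in> ?S}"
        using sets.sets_into_space[OF S'] by (auto simp: space_pair_measure)
      also have "\<dots> \<in> sets (Pi\<^sub>M ?J thrM)"
      proof -
        have [measurable]: "(\<lambda>y. merge ?I ?J (x, y)) \<in> measurable (Pi\<^sub>M ?J thrM) (Pi\<^sub>M (?I \<union> ?J)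
          thrM)"
          using that by measurable
        have [measurable]: "?S \<in> sets (Pi\<^sub>M (?I \<union> ?J) thrM)"
          using \<open>?S = _\<close> \<open>_ \<in> sets (Pi\<^sub>M (V \<times> {1..rounds}) thrM)\<close> unfolding U by simp
        show ?thesis by measurable
      qed
      finally show "{y \<in> space (Pi\<^sub>M ?J thrM). (merge ?I ?J (x, y), i) \<in> S} \<in> sets (Pi\<^sub>M ?J thrM)" .
    qed auto
    then show "emeasure (Pi\<^sub>M ?J thrM) {y \<in> space (Pi\<^sub>M ?J thrM). merge ?I ?J (x, y) \<in>
            {thr \<in> space (Pi\<^sub>M (?I \<union> ?J) thrM). (thr, i) \<in> S}} \<le> c"
      if "x \<in> space (Pi\<^sub>M ?I thrM)"
      using le[of x i] that by (meson order.trans)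
  qed (use finite_V in auto)
qed

section \<open>Probabilities of the failure events\<close>

lemma measure_macM: "k \<in> {1..machines} \<Longrightarrow> measure (macM u) {k} = 1 / real machines"
  by (subst measure_uniform_count_measure) auto

text \<open>Chernoff over the machines of the other vertices, with \<open>k\<close> the machine of
  \<open>v\<close> and \<sigma> selecting the tail. Here \<open>c * b v\<close> bounds
  \<open>machines\<close> times any edge value at \<open>v\<close>, so
  \<open>\<theta> * c \<le> 1\<close> keeps the scaled weights at most 1. The condition on
  \<open>\<theta>\<^sup>2 * c * 2 ^ t\<close> bounds the second-order term by 1, which is the 1 in
  \<open>L + 1\<close>.\<close>

lemma sample_deviation_emeasure_le:
  assumes v: "v \<in> V" and k: "k \<in> {1..machines}" and b: "b v > 0"
    and th: "0 < \<theta>" "\<theta> * c \<le> 1" "\<theta>\<^sup>2 * c * 2 ^ t \<le> 1" "L + 1 \<le> \<theta> * \<epsilon>"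
    and c: "real machines * (2 ^ t * vertex_cap V E b v) \<le> c * b v"
    and sg: "\<bar>\<sigma>\<bar> = 1"
  shows "emeasure (Pi\<^sub>M (V - {v}) macM) {y \<in> space (Pi\<^sub>M (V - {v}) macM).
       \<sigma> * (real machines * (\<Sum>u\<in>nbrs v. if y u = k then sx thr t {u, v} else 0) - seq_load thr t
         v) > \<epsilon> * b v}
     \<le> ennreal (exp (- L))"
proof -
  define w where "w = (\<lambda>u. \<theta> / b v * (real machines * sx thr t {u, v}))"
  \<comment> \<open>Extended by zero to non-neighbours, so that the sum runs over the full index set
    of the product.\<close>
  define a where "a = (\<lambda>u. if u \<in> nbrs v then \<sigma> * w u else 0)"
  have e: "{u, v} \<in> E" if "u \<in> nbrs v" for u using that by (simp add: nbrs_def)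
  have w0: "w u \<ge> 0" if "u \<in> nbrs v" for u
    using th b seq_value_nonneg[OF e[OF that]] by (auto simp: w_def)
  have wc: "w u \<le> \<theta> * c" if "u \<in> nbrs v" for u
  proof -
    have "real machines * sx thr t {u, v} \<le> c * b v"
      using seq_value_le[OF e[OF that], of v thr t] c
      by (meson insertCI mult_left_mono of_nat_0_le_iff order.trans)
    then have "w u \<le> \<theta> / b v * (c * b v)"
      unfolding w_def using th b by (intro mult_left_mono) auto
    then show ?thesis using b by simp
  qed
  have nb: "(\<Sum>u\<in>V - {v}. if u \<in> nbrs v then f u else 0) = (\<Sum>u\<in>nbrs v. f u)" for f :: "'v \<Rightarrow> real"
    using nbrs_subset[of v] finite_V by (intro sum.mono_neutral_cong_right) auto
  have sw: "(\<Sum>u\<in>nbrs v. w u) = \<theta> / b v * (real machines * seq_load thr t v)"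
    by (simp add: w_def seq_load_def sum_distrib_left)
  have m0: "real machines > 0" using machines_pos by simp
  have mean: "(\<Sum>u\<in>V - {v}. 1 / real machines * (a u + (a u)\<^sup>2)) \<le> \<sigma> * (\<theta> / b v * seq_load thr t v)
    + 1"
  proof -
    have "(\<Sum>u\<in>V - {v}. 1 / real machines * (a u + (a u)\<^sup>2))
        = (\<Sum>u\<in>V - {v}. if u \<in> nbrs v then 1 / real machines * (\<sigma> * w u + (w u)\<^sup>2) else 0)"
      using sg by (intro sum.cong) (auto simp: a_def power_mult_distrib power2_eq_1_iff abs_if
        split: if_splits)
    also have "\<dots> = (\<Sum>u\<in>nbrs v. 1 / real machines * (\<sigma> * w u + (w u)\<^sup>2))" by (rule nb)
    also have "\<dots> = 1 / real machines * (\<sigma> * (\<Sum>u\<in>nbrs v. w u)) + 1 / real machines * (\<Sum>u\<in>nbrs v. (w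
      u)\<^sup>2)"
      by (simp add: sum_distrib_left sum.distrib algebra_simps)
    \<comment> \<open>One factor of each square is replaced by the maximal weight, leaving a
      multiple of the sequential load.\<close>
    also have "(\<Sum>u\<in>nbrs v. (w u)\<^sup>2) \<le> (\<Sum>u\<in>nbrs v. \<theta> * c * w u)"
      unfolding power2_eq_square by (intro sum_mono mult_right_mono wc w0)
    also have "\<dots> = \<theta> * c * (\<theta> / b v * (real machines * seq_load thr t v))"
      by (simp only: sum_distrib_left[symmetric] sw)
    also have "\<dots> \<le> real machines * 1"
    proof -
      have cn: "c \<ge> 0"
      proof -
        have "0 \<le> c * b v"
          using c vertex_cap_nonneg[OF v] by (meson mult_nonneg_nonneg of_nat_0_le_iff order.trans
            zero_le_numeral zero_le_power)
        then show ?thesis using b by (simp add: zero_le_mult_iff)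
      qed
      have "0 \<le> 2 ^ t * b v" using b by simp
      then have "seq_load thr t v \<le> 2 ^ t * b v"
        using seq_load_le[OF v, of thr t] by linarith
      then have "\<theta> * c * (\<theta> / b v) * seq_load thr t v \<le> \<theta> * c * (\<theta> / b v) * (2 ^ t * b v)"
        using th b cn by (intro mult_left_mono) auto
      also have "\<dots> = \<theta>\<^sup>2 * c * 2 ^ t" using b by (simp add: power2_eq_square field_simps)
      also have "\<dots> \<le> 1" by (rule th)
      finally have "real machines * (\<theta> * c * (\<theta> / b v) * seq_load thr t v) \<le> real machines * 1"
        using m0 by (intro mult_left_mono) auto
      then show ?thesis by (simp add: mult_ac)
    qed
    finally have "(\<Sum>u\<in>V - {v}. 1 / real machines * (a u + (a u)\<^sup>2))
      \<le> 1 / real machines * (\<sigma> * (\<Sum>u\<in>nbrs v. w u)) + 1 / real machines * (real machines * 1)"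
      using m0 by (simp add: divide_right_mono)
    then show ?thesis using m0 unfolding sw by (simp add: mult_ac)
  qed
  have "emeasure (Pi\<^sub>M (V - {v}) macM) {y \<in> space (Pi\<^sub>M (V - {v}) macM).
         (\<Sum>u\<in>V - {v}. a u * indicator {k} (y u)) \<ge> (\<Sum>u\<in>V - {v}. 1 / real machines * (a u + (a
           u)\<^sup>2)) + L}
       \<le> ennreal (exp (- L))"
  proof (rule chernoff_PiM)
    show "\<bar>a u\<bar> \<le> 1" if "u \<in> V - {v}" for u
      using sg w0[of u] wc[of u] th(2) by (auto simp: a_def abs_mult)
    show "1 / real machines = measure (macM u) {k}" for u using measure_macM[OF k] by simp
    show "{k} \<in> sets (macM u)" for u using k by (simp add: sets_uniform_count_measure)
  qed (use finite_V prob_space_macM in auto)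
  moreover have "{y \<in> space (Pi\<^sub>M (V - {v}) macM).
       \<sigma> * (real machines * (\<Sum>u\<in>nbrs v. if y u = k then sx thr t {u, v} else 0) - seq_load thr t
         v) > \<epsilon> * b v}
     \<subseteq> {y \<in> space (Pi\<^sub>M (V - {v}) macM).
         (\<Sum>u\<in>V - {v}. a u * indicator {k} (y u)) \<ge> (\<Sum>u\<in>V - {v}. 1 / real machines * (a u + (a
           u)\<^sup>2)) + L}"
  proof (intro subsetI CollectI conjI; elim CollectE conjE)
    fix y
    let ?s = "\<Sum>u\<in>nbrs v. if y u = k then sx thr t {u, v} else 0"
    assume "\<sigma> * (real machines * ?s - seq_load thr t v) > \<epsilon> * b v"
    then have "\<theta> / b v * (\<sigma> * (real machines * ?s - seq_load thr t v)) > \<theta> / b v * (\<epsilon> * b v)"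
      using th b by (intro mult_strict_left_mono) auto
    also have "\<theta> / b v * (\<epsilon> * b v) = \<theta> * \<epsilon>" using b by simp
    finally have "\<theta> / b v * (\<sigma> * (real machines * ?s)) \<ge> \<sigma> * (\<theta> / b v * seq_load thr t v) + (L + 1)"
      using th(4) by (simp add: algebra_simps)
    moreover have "(\<Sum>u\<in>V - {v}. a u * indicator {k} (y u)) = \<theta> / b v * (\<sigma> * (real machines * ?s))"
    proof -
      have "(\<Sum>u\<in>V - {v}. a u * indicator {k} (y u)) =
        (\<Sum>u\<in>V - {v}. if u \<in> nbrs v then \<theta> / b v * (\<sigma> * (real machines * (if y u = k then sx thr t
          {u, v} else 0))) else 0)"
        by (intro sum.cong) (auto simp: a_def w_def indicator_def)
      also have "\<dots> = \<theta> / b v * (\<sigma> * (real machines * ?s))"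
        unfolding nb by (simp only: sum_distrib_left)
      finally show ?thesis .
    qed
    ultimately show "(\<Sum>u\<in>V - {v}. a u * indicator {k} (y u)) \<ge> (\<Sum>u\<in>V - {v}. 1 / real machines * (a
      u + (a u)\<^sup>2)) + L"
      using mean by linarith
  qed auto
  moreover have "{y \<in> space (Pi\<^sub>M (V - {v}) macM).
         (\<Sum>u\<in>V - {v}. a u * indicator {k} (y u)) \<ge> (\<Sum>u\<in>V - {v}. 1 / real machines * (a u + (a
           u)\<^sup>2)) + L}
      \<in> sets (Pi\<^sub>M (V - {v}) macM)"
  proof -
    have [measurable]: "(\<lambda>y. indicator {k} (y u) :: real) \<in> borel_measurable (Pi\<^sub>M (V - {v})
      macM)" if "u \<in> V - {v}" for u
    proof -
      have [measurable]: "{k} \<in> sets (macM u)" using k by (simp add: sets_uniform_count_measure)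
      show ?thesis using that by measurable
    qed
    show ?thesis by measurable
  qed
  ultimately show ?thesis by (meson emeasure_mono order.trans)
qed

text \<open>Thresholds and the machine of \<open>v\<close> are frozen in turn; the factor 2 is the
  union over both tails.\<close>

lemma emeasure_sample_fails_le:
  assumes v: "v \<in> V" and t: "t \<le> rounds"
    and th: "0 < \<theta>" "\<theta> * c \<le> 1" "\<theta>\<^sup>2 * c * 2 ^ t \<le> 1" "L + 1 \<le> \<theta> * \<epsilon>"
    and c: "real machines * (2 ^ t * vertex_cap V E b v) \<le> c * b v"
  shows "emeasure coup {\<omega> \<in> space coup. sample_fails \<epsilon> (fst \<omega>) (snd \<omega>) t v} \<le> ennreal (2 * exp (-
    L))"
proof (cases "b v = 0")
  case True
  \<comment> \<open>A zero budget makes the cap of \<open>v\<close> zero, so all values at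
    \<open>v\<close> vanish and the strict inequality cannot hold.\<close>
  have "sx thr t {u, v} = 0" if "u \<in> nbrs v" for thr u
    using seq_value_le[of "{u, v}" v thr t] seq_value_nonneg[of "{u, v}" thr t] True that
    by (auto simp: nbrs_def vertex_cap_def)
  then have "\<not> sample_fails \<epsilon> thr i t v" for thr i
    using True by (simp add: sample_fails_def sampled_load_def seq_load_def cong: sum.cong if_cong)
  then show ?thesis by simp
next
  case False
  then have b: "b v > 0" using b_nonneg[OF v] by simp
  let ?S = "{\<omega> \<in> space coup. sample_fails \<epsilon> (fst \<omega>) (snd \<omega>) t v}"
  have S: "?S \<in> sets (Pi\<^sub>M (V \<times> {1..rounds}) thrM \<Otimes>\<^sub>M Pi\<^sub>M V macM)"
    using sample_fails_sets[OF t v] by (simp add: coupling_eq)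
  have "emeasure (Pi\<^sub>M (V \<times> {1..rounds}) thrM \<Otimes>\<^sub>M Pi\<^sub>M V macM) ?S \<le> ennreal (2 * exp (- L))"
  proof (rule emeasure_pair_le_slice1[OF prob_space_thrs prob_space_macs S])
    fix thr assume thr: "thr \<in> space (Pi\<^sub>M (V \<times> {1..rounds}) thrM)"
    let ?Q = "{i \<in> space (Pi\<^sub>M V macM). (thr, i) \<in> ?S}"
    have U: "V = {v} \<union> (V - {v})" using v by auto
    have Q: "?Q \<in> sets (Pi\<^sub>M V macM)"
    proof -
      have "?Q = Pair thr -` ?S"
        by (auto simp: coupling_eq space_pair_measure)
      then show ?thesis using sets_Pair1[OF S, of thr] by simp
    qed
    have "emeasure (Pi\<^sub>M ({v} \<union> (V - {v})) macM) ?Q \<le> ennreal (2 * exp (- L))"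
    proof (rule emeasure_PiM_le_slice[OF prob_space_macM])
      show "?Q \<in> sets (Pi\<^sub>M ({v} \<union> (V - {v})) macM)" using Q U by simp
      fix x assume "x \<in> space (Pi\<^sub>M {v} macM)"
      then have k: "x v \<in> {1..machines}"
        by (auto simp: space_PiM PiE_iff space_uniform_count_measure)
      let ?D = "\<lambda>\<sigma> y. \<sigma> * (real machines * (\<Sum>u\<in>nbrs v. if y u = x v then sx thr t {u, v} else 0) -
        seq_load thr t v) > \<epsilon> * b v"
      let ?P = "Pi\<^sub>M (V - {v}) macM"
      have meas: "{y \<in> space ?P. ?D \<sigma> y} \<in> sets ?P" for \<sigma>
      proof -
        have [measurable]: "(\<lambda>y. if y u = x v then sx thr t {u, v} else 0) \<in> borel_measurable ?P"
          if "u \<in> nbrs v" for u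
        proof -
          have "{x v} \<in> sets (macM u)" using k by (simp add: sets_uniform_count_measure)
          moreover have "u \<in> V - {v}" using that nbrs_subset by auto
          ultimately have "(\<lambda>y. indicator {x v} (y u) * sx thr t {u, v}) \<in> borel_measurable ?P" by
            measurable
          also have "(\<lambda>y. indicator {x v} (y u) * sx thr t {u, v}) = (\<lambda>y. if y u = x v then sx thr
            t {u, v} else 0)"
            by (auto simp: fun_eq_iff)
          finally show ?thesis .
        qed
        show ?thesis by measurable
      qed
      have "emeasure ?P {y \<in> space ?P. merge {v} (V - {v}) (x, y) \<in> ?Q}
          \<le> emeasure ?P ({y \<in> space ?P. ?D 1 y} \<union> {y \<in> space ?P. ?D (-1) y})"
      proof (rule emeasure_mono)
        show "{y \<in> space ?P. ?D 1 y} \<union> {y \<in> space ?P. ?D (-1) y} \<in> sets ?P" using meas by blast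
        show "{y \<in> space ?P. merge {v} (V - {v}) (x, y) \<in> ?Q} \<subseteq> {y \<in> space ?P. ?D 1 y} \<union> {y \<in>
          space ?P. ?D (-1) y}"
        proof
          fix y assume y: "y \<in> {y \<in> space ?P. merge {v} (V - {v}) (x, y) \<in> ?Q}"
          have "sampled_load thr (merge {v} (V - {v}) (x, y)) t v =
              real machines * (\<Sum>u\<in>nbrs v. if y u = x v then sx thr t {u, v} else 0)"
            unfolding sampled_load_def using nbrs_subset[of v]
            by (intro arg_cong2[where f="(*)"] sum.cong) (auto simp: merge_def)
          then show "y \<in> {y \<in> space ?P. ?D 1 y} \<union> {y \<in> space ?P. ?D (-1) y}"
            using y by (auto simp: sample_fails_def abs_if split: if_splits)
        qed
      qed
      also have "\<dots> \<le> emeasure ?P {y \<in> space ?P. ?D 1 y} + emeasure ?P {y \<in> space ?P. ?D (-1) y}"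
        by (intro emeasure_subadditive meas)
      also have "\<dots> \<le> ennreal (exp (- L)) + ennreal (exp (- L))"
        by (intro add_mono sample_deviation_emeasure_le[OF v k b th c]) auto
      also have "\<dots> = ennreal (2 * exp (- L))" by (simp add: ennreal_plus[symmetric] del:
        ennreal_plus)
      finally show "emeasure ?P {y \<in> space ?P. merge {v} (V - {v}) (x, y) \<in> ?Q} \<le> ennreal (2 * exp
        (- L))" .
    qed (use finite_V in auto)
    then show "emeasure (Pi\<^sub>M V macM) ?Q \<le> ennreal (2 * exp (- L))" using U by simp
  qed
  then show ?thesis by (simp add: coupling_eq)
qed

text \<open>Once everything but round \<open>Suc t\<close> is frozen, the gap is a fixed set and the
  event concerns the single coordinate \<open>(v, Suc t)\<close>.\<close>

lemma emeasure_flips_le: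
  assumes v: "v \<in> V" and t: "t < rounds" and d: "\<delta> \<ge> 0"
  shows "emeasure coup {\<omega> \<in> space coup. flips \<delta> (fst \<omega>) (snd \<omega>) t v} \<le> ennreal (5 * \<delta>)"
proof (rule emeasure_coupling_le_step[OF t flips_sets[OF t v]])
  fix x :: "'v \<times> nat \<Rightarrow> real" and i
  let ?m = "\<lambda>y. merge (V \<times> ({1..rounds} - {Suc t})) (V \<times> {Suc t}) (x, y)"
  let ?P = "Pi\<^sub>M (V \<times> {Suc t}) thrM"
  \<comment> \<open>The 0 is a placeholder for the thresholds of round \<open>Suc t\<close>, which
    the gap of round \<open>t\<close> does not read.\<close>
  define thr where "thr = ?m (\<lambda>_. 0)"
  have g: "gap \<delta> (?m y) i t = gap \<delta> thr i t" for y
    by (rule loads_cong) (use t in \<open>auto simp: thr_def merge_def\<close>)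
  have mv: "?m y (v, Suc t) = y (v, Suc t)" for y using v by (auto simp: merge_def)
  have "emeasure ?P {y \<in> space ?P. (?m y, i) \<in> {\<omega> \<in> space coup. flips \<delta> (fst \<omega>) (snd \<omega>) t v}}
      \<le> emeasure ?P {y \<in> space ?P. y (v, Suc t) \<in> gap \<delta> thr i t v}"
  proof (rule emeasure_mono)
    show "{y \<in> space ?P. (?m y, i) \<in> {\<omega> \<in> space coup. flips \<delta> (fst \<omega>) (snd \<omega>) t v}}
      \<subseteq> {y \<in> space ?P. y (v, Suc t) \<in> gap \<delta> thr i t v}"
      unfolding flips_iff_gap mem_Collect_eq fst_conv snd_conv g mv by blast
    have [measurable]: "(\<lambda>y. y (v, Suc t)) \<in> borel_measurable ?P"
      using measurable_component_singleton[of "(v, Suc t)" "V \<times> {Suc t}" thrM] v by simp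
    show "{y \<in> space ?P. y (v, Suc t) \<in> gap \<delta> thr i t v} \<in> sets ?P"
      using measurable_gap[of \<delta> thr i t v] by measurable
  qed
  also have "\<dots> = emeasure (thrM (v, Suc t)) (gap \<delta> thr i t v)"
    using v measurable_gap by (intro emeasure_PiM_component_set prob_space_thrM) auto
  also have "\<dots> \<le> ennreal (5 * \<delta>)" by (rule emeasure_gap_le[OF v d])
  finally show "emeasure ?P {y \<in> space ?P. (?m y, i) \<in> {\<omega> \<in> space coup. flips \<delta> (fst \<omega>) (snd \<omega>) t
    v}} \<le> ennreal (5 * \<delta>)" .
qed

text \<open>The sample space admits arbitrary real thresholds, so their upper limit holds only
  almost surely and its violation joins the union bound as a null event.\<close>

lemma emeasure_thr_exceeds:
  assumes v: "v \<in> V" and t: "t < rounds"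
  shows "emeasure coup {\<omega> \<in> space coup. fst \<omega> (v, Suc t) > 0.4 * b v} \<le> 0"
proof -
  have [measurable]: "(\<lambda>\<omega>. fst \<omega> (v, Suc t)) \<in> borel_measurable coup"
    using assms by (intro measurable_coupling_thr) auto
  have S: "{\<omega> \<in> space coup. fst \<omega> (v, Suc t) > 0.4 * b v} \<in> sets coup" by measurable
  show ?thesis
  proof (rule emeasure_coupling_le_step[OF t S])
    fix x :: "'v \<times> nat \<Rightarrow> real" and i
    let ?m = "\<lambda>y. merge (V \<times> ({1..rounds} - {Suc t})) (V \<times> {Suc t}) (x, y)"
    let ?P = "Pi\<^sub>M (V \<times> {Suc t}) thrM"
    have "emeasure ?P {y \<in> space ?P. (?m y, i) \<in> {\<omega> \<in> space coup. fst \<omega> (v, Suc t) > 0.4 * b v}}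
      \<le> emeasure ?P {y \<in> space ?P. y (v, Suc t) \<in> {0.4 * b v <..}}"
    proof (rule emeasure_mono)
      show "{y \<in> space ?P. (?m y, i) \<in> {\<omega> \<in> space coup. fst \<omega> (v, Suc t) > 0.4 * b v}}
        \<subseteq> {y \<in> space ?P. y (v, Suc t) \<in> {0.4 * b v <..}}"
        using v by (auto simp: merge_def)
      have [measurable]: "(\<lambda>y. y (v, Suc t)) \<in> borel_measurable ?P"
        using measurable_component_singleton[of "(v, Suc t)" "V \<times> {Suc t}" thrM] v by simp
      show "{y \<in> space ?P. y (v, Suc t) \<in> {0.4 * b v <..}} \<in> sets ?P"
        by measurable
    qed
    also have "\<dots> = emeasure (thrM (v, Suc t)) {0.4 * b v <..}"
      using v by (intro emeasure_PiM_component_set prob_space_thrM) auto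
    also have "\<dots> = 0" unfolding fst_conv
      using b_nonneg[OF v] by (intro emeasure_uniform_interval_greaterThan) auto
    finally show "emeasure ?P {y \<in> space ?P. (?m y, i) \<in> {\<omega> \<in> space coup. fst \<omega> (v, Suc t) > 0.4 *
      b v}} \<le> 0" .
  qed
qed

text \<open>With the gaps frozen, the flips of distinct neighbours are independent events of the
  fresh thresholds, each of probability at most \<open>5 * \<delta>\<close>, where \<delta>
  abbreviates \<open>13 ^ t * \<epsilon>\<close>. Chernoff then applies to their weighted
  sum.\<close>

lemma emeasure_flip_fails_le:
  assumes v: "v \<in> V" and t: "t < rounds" and eps: "\<epsilon> \<ge> 0"
    and th: "0 < \<theta>" "\<theta> * c \<le> 1" "L \<le> \<theta> * \<epsilon>"
    and c: "real machines * (2 ^ t * vertex_cap V E b v) \<le> c * b v"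
  shows "emeasure coup {\<omega> \<in> space coup. flip_fails \<epsilon> (fst \<omega>) (snd \<omega>) t v} \<le> ennreal (exp (- L))"
proof (cases "b v = 0")
  case True
  have "sx thr t {u, v} = 0" if "u \<in> nbrs v" for thr u
    using seq_value_le[of "{u, v}" v thr t] seq_value_nonneg[of "{u, v}" thr t] True that
    by (auto simp: nbrs_def vertex_cap_def)
  then have "\<not> flip_fails \<epsilon> thr i t v" for thr i
    using True by (simp add: flip_fails_def sampled_load_def flip_weight_def cong: sum.cong if_cong)
  then show ?thesis by simp
next
  case False
  then have b: "b v > 0" using b_nonneg[OF v] by simp
  define \<delta> where "\<delta> = 13 ^ t * \<epsilon>"
  have d0: "\<delta> \<ge> 0" using eps by (simp add: \<delta>_def)
  show ?thesis
  proof (rule emeasure_coupling_le_step[OF t flip_fails_sets[OF t v]])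
    fix x :: "'v \<times> nat \<Rightarrow> real" and i
    let ?m = "\<lambda>y. merge (V \<times> ({1..rounds} - {Suc t})) (V \<times> {Suc t}) (x, y)"
    let ?P = "Pi\<^sub>M (V \<times> {Suc t}) thrM"
    define thr where "thr = ?m (\<lambda>_. 0)"
    have eq: "?m y (u, s) = thr (u, s)" if "s \<in> {1..t}" for y u s
      using that t by (auto simp: thr_def merge_def)
    note cong = loads_cong[of t "?m y" thr for y, OF eq]
    define w where "w = (\<lambda>u. \<theta> / b v * (real machines * sx thr t {u, v}))"
    define A where "A = (\<lambda>p :: 'v \<times> nat. gap \<delta> thr i t (fst p))"
    define p where "p = (\<lambda>q. measure (thrM q) (A q))"
    \<comment> \<open>Machines are frozen here, so locality belongs to the weight while the flip is
      the random event \<open>A\<close>.\<close>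
    define a where "a = (\<lambda>q :: 'v \<times> nat. if fst q \<in> nbrs v \<and> i (fst q) = i v then w (fst q) else 0)"
    have e: "{u, v} \<in> E" if "u \<in> nbrs v" for u using that by (simp add: nbrs_def)
    have w0: "w u \<ge> 0" if "u \<in> nbrs v" for u
      using th b seq_value_nonneg[OF e[OF that]] by (auto simp: w_def)
    have wc: "w u \<le> 1" if "u \<in> nbrs v" for u
    proof -
      have "real machines * sx thr t {u, v} \<le> c * b v"
        using seq_value_le[OF e[OF that], of v thr t] c
        by (meson insertCI mult_left_mono of_nat_0_le_iff order.trans)
      then have "w u \<le> \<theta> / b v * (c * b v)"
        unfolding w_def using th b by (intro mult_left_mono) auto
      then show ?thesis using b th by simp
    qed
    have a01: "0 \<le> a q" "a q \<le> 1" for q using w0 wc by (auto simp: a_def)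
    have p: "p q \<le> 5 * \<delta>" "p q \<ge> 0" if "q \<in> V \<times> {Suc t}" for q
    proof -
      interpret prob_space "thrM q" by (rule prob_space_thrM)
      have "emeasure (thrM q) (A q) \<le> ennreal (5 * \<delta>)"
        using that d0 emeasure_gap_le[of "fst q" \<delta> "snd q" thr i t] by (auto simp: A_def)
      then show "p q \<le> 5 * \<delta>"
        unfolding emeasure_eq_measure using d0 by (simp only: p_def ennreal_le_iff)
    qed (simp add: p_def)
    have nb: "(\<Sum>q\<in>V \<times> {Suc t}. if fst q \<in> nbrs v then f q else 0) = (\<Sum>u\<in>nbrs v. f (u, Suc t))"
      for f :: "'v \<times> nat \<Rightarrow> real"
    proof -
      have "(\<Sum>q\<in>V \<times> {Suc t}. if fst q \<in> nbrs v then f q else 0)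
          = (\<Sum>u\<in>V. if u \<in> nbrs v then f (u, Suc t) else 0)"
        by (rule sum.reindex_bij_witness[of _ "\<lambda>u. (u, Suc t)" fst]) auto
      also have "\<dots> = (\<Sum>u\<in>nbrs v. f (u, Suc t))"
        using nbrs_subset[of v] finite_V by (intro sum.mono_neutral_cong_right) auto
      finally show ?thesis .
    qed
    have mean: "(\<Sum>q\<in>V \<times> {Suc t}. p q * (a q + (a q)\<^sup>2)) \<le> \<theta> / b v * (10 * \<delta> * sampled_load thr i t
      v)"
    proof -
      \<comment> \<open>Weights in the unit interval satisfy \<open>(a q)\<^sup>2 \<le> a q\<close>;
        this doubling turns \<open>5 * \<delta>\<close> into \<open>10 * \<delta>\<close>.\<close>
      have "(\<Sum>q\<in>V \<times> {Suc t}. p q * (a q + (a q)\<^sup>2)) \<le> (\<Sum>q\<in>V \<times> {Suc t}. 5 * \<delta> * (2 * a q))"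
      proof (intro sum_mono mult_mono p)
        fix q show "a q + (a q)\<^sup>2 \<le> 2 * a q"
          using mult_left_mono[OF a01(2) a01(1), of q q] by (simp add: power2_eq_square)
      qed (use a01 d0 in auto)
      also have "\<dots> = (\<Sum>q\<in>V \<times> {Suc t}. if fst q \<in> nbrs v
          then \<theta> / b v * (10 * \<delta> * (real machines * (if i (fst q) = i v then sx thr t {fst q, v}
            else 0))) else 0)"
        by (intro sum.cong) (auto simp: a_def w_def)
      also have "\<dots> = \<theta> / b v * (10 * \<delta> * sampled_load thr i t v)"
        unfolding nb sampled_load_def fst_conv by (simp only: sum_distrib_left)
      finally show ?thesis .
    qed
    let ?C = "{y \<in> space ?P. (\<Sum>q\<in>V \<times> {Suc t}. a q * indicator (A q) (y q))
        \<ge> (\<Sum>q\<in>V \<times> {Suc t}. p q * (a q + (a q)\<^sup>2)) + L}"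
    have "emeasure ?P ?C \<le> ennreal (exp (- L))"
      by (rule chernoff_PiM[OF prob_space_thrM])
        (use finite_V a01 measurable_gap in \<open>auto simp: p_def A_def abs_of_nonneg\<close>)
    moreover have "?C \<in> sets ?P"
    proof -
      have [measurable]: "(\<lambda>y. indicator (A q) (y q) :: real) \<in> borel_measurable ?P" if "q \<in> V \<times>
        {Suc t}" for q
      proof -
        have [measurable]: "A q \<in> sets (thrM q)" using measurable_gap by (simp add: A_def)
        show ?thesis using that by measurable
      qed
      show ?thesis by measurable
    qed
    moreover have "{y \<in> space ?P. (?m y, i) \<in> {\<omega> \<in> space coup. flip_fails \<epsilon> (fst \<omega>) (snd \<omega>) t v}}
      \<subseteq> ?C"
    proof (intro subsetI CollectI conjI; elim CollectE conjE)
      fix y assume "(?m y, i) \<in> space coup" "flip_fails \<epsilon> (fst (?m y, i)) (snd (?m y, i)) t v"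
      then have "flip_weight \<delta> (?m y) i t v > 10 * \<delta> * sampled_load thr i t v + \<epsilon> * b v"
        by (simp only: flip_fails_def \<delta>_def[symmetric] fst_conv snd_conv cong)
      then have "\<theta> / b v * flip_weight \<delta> (?m y) i t v > \<theta> / b v * (10 * \<delta> * sampled_load thr i t v
        + \<epsilon> * b v)"
        using th b by (intro mult_strict_left_mono) auto
      moreover have "\<theta> / b v * (10 * \<delta> * sampled_load thr i t v + \<epsilon> * b v)
          = \<theta> / b v * (10 * \<delta> * sampled_load thr i t v) + \<theta> * \<epsilon>"
        using b by (simp add: algebra_simps)
      moreover have "\<theta> / b v * flip_weight \<delta> (?m y) i t v = (\<Sum>q\<in>V \<times> {Suc t}. a q * indicator (A q)
        (y q))"
      proof -
        have "(\<Sum>q\<in>V \<times> {Suc t}. a q * indicator (A q) (y q)) = (\<Sum>q\<in>V \<times> {Suc t}. if fst q \<in> nbrs v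
          then
           \<theta> / b v * (real machines * (if i (fst q) = i v \<and> y q \<in> gap \<delta> thr i t (fst q) then sx
             thr t {fst q, v} else 0)) else 0)"
          by (intro sum.cong) (auto simp: a_def w_def A_def indicator_def)
        also have "\<dots> = \<theta> / b v * (real machines * (\<Sum>u\<in>nbrs v.
            if i u = i v \<and> y (u, Suc t) \<in> gap \<delta> thr i t u then sx thr t {u, v} else 0))"
          unfolding nb fst_conv by (simp only: sum_distrib_left)
        also have "(\<Sum>u\<in>nbrs v. if i u = i v \<and> y (u, Suc t) \<in> gap \<delta> thr i t u then sx thr t {u, v}
          else 0)
          = (\<Sum>u\<in>nbrs v. if i u = i v \<and> flips \<delta> (?m y) i t u then sx (?m y) t {u, v} else 0)"
        proof (rule sum.cong[OF refl])
          fix u assume "u \<in> nbrs v"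
          then have "?m y (u, Suc t) = y (u, Suc t)" using nbrs_subset by (auto simp: merge_def)
          then show "(if i u = i v \<and> y (u, Suc t) \<in> gap \<delta> thr i t u then sx thr t {u, v} else 0)
            = (if i u = i v \<and> flips \<delta> (?m y) i t u then sx (?m y) t {u, v} else 0)"
            by (simp only: flips_iff_gap cong)
        qed
        finally show ?thesis by (simp only: flip_weight_def)
      qed
      ultimately show "(\<Sum>q\<in>V \<times> {Suc t}. a q * indicator (A q) (y q))
        \<ge> (\<Sum>q\<in>V \<times> {Suc t}. p q * (a q + (a q)\<^sup>2)) + L"
        using mean th(3) by linarith
    qed auto
    ultimately show "emeasure ?P {y \<in> space ?P. (?m y, i) \<in> {\<omega> \<in> space coup. flip_fails \<epsilon> (fst \<omega>)
      (snd \<omega>) t v}}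
        \<le> ennreal (exp (- L))"
      by (meson emeasure_mono order.trans)
  qed
qed

section \<open>The union bound\<close>

text \<open>The failure events are summed over all vertices and earlier rounds, since the error at
  \<open>v\<close> depends on its neighbours recursively; flips are summed for \<open>v\<close>
  alone. The 3 collects two sampling tails and one flip tail.\<close>

lemma prob_sym_diff_le:
  assumes v: "v \<in> V" and t: "t \<le> rounds" and eps: "0 \<le> \<epsilon>" "\<epsilon> \<le> 0.1"
    and th: "0 < \<theta>" "\<theta> * c \<le> 1" "\<theta>\<^sup>2 * c * 2 ^ rounds \<le> 1" "L + 1 \<le> \<theta> * \<epsilon>"
    and c: "0 \<le> c" "\<And>u. u \<in> V \<Longrightarrow> real machines * (2 ^ rounds * vertex_cap V E b u) \<le> c * b u"
  shows "measure coup {\<omega> \<in> space coup. v \<in> sym_diff (sa (fst \<omega>) t) (ma (fst \<omega>) (snd \<omega>) t)}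
    \<le> real t * (real (card V) * (3 * exp (- L))) + (\<Sum>s<t. 5 * (13 ^ s * \<epsilon>))"
proof -
  interpret prob_space coup by (rule prob_space_coupling[OF machines_pos])
  have pow: "(2::real) ^ s \<le> 2 ^ rounds" if "s < t" for s
    using that t by (intro power_increasing) auto
  have th': "\<theta>\<^sup>2 * c * 2 ^ s \<le> 1" if "s < t" for s
    using mult_left_mono[OF pow[OF that], of "\<theta>\<^sup>2 * c"] th(3) c(1) by simp
  have c': "real machines * (2 ^ s * vertex_cap V E b u) \<le> c * b u" if "s < t" "u \<in> V" for s u
  proof -
    have "real machines * (2 ^ s * vertex_cap V E b u) \<le> real machines * (2 ^ rounds * vertex_cap
      V E b u)"
      by (intro mult_left_mono mult_right_mono pow that vertex_cap_nonneg) auto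
    with c(2)[OF that(2)] show ?thesis by linarith
  qed
  define X where "X = (\<lambda>s u. {\<omega> \<in> space coup. fst \<omega> (u, Suc s) > 0.4 * b u})"
  define Y where "Y = (\<lambda>s u. {\<omega> \<in> space coup. sample_fails \<epsilon> (fst \<omega>) (snd \<omega>) s u})"
  define Z where "Z = (\<lambda>s u. {\<omega> \<in> space coup. flip_fails \<epsilon> (fst \<omega>) (snd \<omega>) s u})"
  define F where "F = (\<lambda>s. {\<omega> \<in> space coup. flips (13 ^ s * \<epsilon>) (fst \<omega>) (snd \<omega>) s v})"
  have Xs: "X s u \<in> sets coup" if "s < t" "u \<in> V" for s u
  proof -
    have [measurable]: "(\<lambda>\<omega>. fst \<omega> (u, Suc s)) \<in> borel_measurable coup"
      using that t by (intro measurable_coupling_thr) auto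
    show ?thesis unfolding X_def by measurable
  qed
  have Ys: "Y s u \<in> sets coup" if "s < t" "u \<in> V" for s u
    unfolding Y_def using that t by (intro sample_fails_sets) auto
  have Zs: "Z s u \<in> sets coup" if "s < t" "u \<in> V" for s u
    unfolding Z_def using that t by (intro flip_fails_sets) auto
  have Fs: "F s \<in> sets coup" if "s < t" for s
    unfolding F_def using that t v by (intro flips_sets) auto
  have mX: "measure coup (X s u) \<le> 0" if "s < t" "u \<in> V" for s u
    using emeasure_thr_exceeds[of u s] that t by (simp add: X_def emeasure_eq_measure)
  have mY: "measure coup (Y s u) \<le> 2 * exp (- L)" if "s < t" "u \<in> V" for s u
    using emeasure_sample_fails_le[of u s \<theta> c L \<epsilon>] th' th c' that t
    by (simp add: Y_def emeasure_eq_measure)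
  have mZ: "measure coup (Z s u) \<le> exp (- L)" if "s < t" "u \<in> V" for s u
    using emeasure_flip_fails_le[of u s \<epsilon> \<theta> c L] th c' eps that t
    by (simp add: Z_def emeasure_eq_measure)
  have mF: "measure coup (F s) \<le> 5 * (13 ^ s * \<epsilon>)" if "s < t" for s
    using emeasure_flips_le[of v s "13 ^ s * \<epsilon>"] v eps that t
    by (simp add: F_def emeasure_eq_measure)
  define B where "B = (\<lambda>s u. X s u \<union> Y s u \<union> Z s u)"
  have Bs: "B s u \<in> sets coup" if "s < t" "u \<in> V" for s u
    unfolding B_def using Xs Ys Zs that by blast
  have mB: "measure coup (B s u) \<le> 3 * exp (- L)" if "s < t" "u \<in> V" for s u
  proof -
    have "measure coup (B s u) \<le> measure coup (X s u) + measure coup (Y s u) + measure coup (Z s u)"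
      unfolding B_def using Xs[OF that] Ys[OF that] Zs[OF that]
      by (intro order.trans[OF measure_Un_le] add_right_mono) (auto intro: measure_Un_le)
    then show ?thesis using mX[OF that] mY[OF that] mZ[OF that] by linarith
  qed
  have Us: "(\<Union>s<t. \<Union>u\<in>V. B s u) \<in> sets coup" "(\<Union>s<t. F s) \<in> sets coup"
    using Bs Fs finite_V by (auto intro!: sets.finite_UN)
  have "measure coup {\<omega> \<in> space coup. v \<in> sym_diff (sa (fst \<omega>) t) (ma (fst \<omega>) (snd \<omega>) t)}
      \<le> measure coup ((\<Union>s<t. \<Union>u\<in>V. B s u) \<union> (\<Union>s<t. F s))"
  proof (rule finite_measure_mono)
    show "{\<omega> \<in> space coup. v \<in> sym_diff (sa (fst \<omega>) t) (ma (fst \<omega>) (snd \<omega>) t)}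
        \<subseteq> (\<Union>s<t. \<Union>u\<in>V. B s u) \<union> (\<Union>s<t. F s)"
    proof
      \<comment> \<open>Disagreement in round \<open>t\<close> itself already refutes
        \<open>good\<close>, which covers every round up to \<open>t\<close>.\<close>
      fix \<omega> assume "\<omega> \<in> {\<omega> \<in> space coup. v \<in> sym_diff (sa (fst \<omega>) t) (ma (fst \<omega>) (snd \<omega>) t)}"
      then have w: "\<omega> \<in> space coup" "\<not> good (fst \<omega>) (snd \<omega>) t v"
        by (auto simp: good_def)
      show "\<omega> \<in> (\<Union>s<t. \<Union>u\<in>V. B s u) \<union> (\<Union>s<t. F s)"
      proof (rule ccontr)
        assume n: "\<omega> \<notin> (\<Union>s<t. \<Union>u\<in>V. B s u) \<union> (\<Union>s<t. F s)"
        have "\<exists>s<t. flips (13 ^ s * \<epsilon>) (fst \<omega>) (snd \<omega>) s v"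
          by (rule bad_imp_flips[OF eps _ _ v w(2)])
            (use n w(1) in \<open>force simp: B_def X_def Y_def Z_def\<close>)+
        with n w(1) show False by (auto simp: F_def)
      qed
    qed
    show "(\<Union>s<t. \<Union>u\<in>V. B s u) \<union> (\<Union>s<t. F s) \<in> sets coup" using Us by blast
  qed
  also have "\<dots> \<le> measure coup (\<Union>s<t. \<Union>u\<in>V. B s u) + measure coup (\<Union>s<t. F s)"
    using Us by (rule measure_Un_le)
  also have "measure coup (\<Union>s<t. F s) \<le> (\<Sum>s<t. measure coup (F s))"
    using Fs by (intro finite_measure_subadditive_finite) auto
  also have "\<dots> \<le> (\<Sum>s<t. 5 * (13 ^ s * \<epsilon>))"
    by (intro sum_mono mF) auto
  also have "measure coup (\<Union>s<t. \<Union>u\<in>V. B s u) \<le> (\<Sum>s<t. measure coup (\<Union>u\<in>V. B s u))"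
    using Bs finite_V by (intro finite_measure_subadditive_finite) (auto intro!: sets.finite_UN)
  also have "\<dots> \<le> (\<Sum>s<t. \<Sum>u\<in>V. measure coup (B s u))"
    using Bs finite_V by (intro sum_mono finite_measure_subadditive_finite) auto
  also have "\<dots> \<le> (\<Sum>s<t. \<Sum>u\<in>V. 3 * exp (- L))"
    by (intro sum_mono mB) auto
  also have "\<dots> = real t * (real (card V) * (3 * exp (- L)))" by simp
  finally show ?thesis by simp
qed

end

section \<open>Choice of the parameters\<close>

lemma sum_13_le_sum_100: "(\<Sum>s<t. 5 * 13 ^ s) \<le> (\<Sum>l=0..t. 100 ^ l :: real)"
proof (induction t)
  case (Suc t)
  \<comment> \<open>The summand for \<open>s\<close> is charged to the summand for
    \<open>l = s + 1\<close>; the one for \<open>l = 0\<close> is spare.\<close>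
  have "5 * (13::real) ^ t \<le> 100 * 100 ^ t" by (intro mult_mono power_mono) auto
  with Suc show ?case by simp
qed simp

theorem theorem3p27:
  shows "\<exists>n\<^sub>0 :: nat. \<forall>(V :: 'v set) (E :: 'v set set) (b :: 'v \<Rightarrow> real) (r :: 'v set \<Rightarrow> real).
    simple_graph V E \<longrightarrow> card V \<ge> n\<^sub>0 \<longrightarrow>
    real (card E) \<ge> real (card V) * ln (real (card V)) ^ 10 \<longrightarrow>
    (\<forall>v\<in>V. b v \<ge> 0) \<longrightarrow> (\<forall>e\<in>E. r e \<ge> 0) \<longrightarrow>
    (\<forall>v\<in>V. \<forall>t\<in>{0..num_rounds V E}.
       \<P>((thr, i) in coupling V E b.
          v \<in> sym_diff (seq_active V E b r thr t) (mpc_active V E b r thr i t))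
       \<le> real t / real (card V) + (\<Sum>l=0..t. rho V E l))"
\<comment> \<open>This makes \<open>ln n\<close> at least \<open>10 ^ 5\<close>, whose power 0.2 is
  10. That is the constant needed in the comparison of \<open>L + 1\<close> with
  \<open>\<theta> * \<epsilon>\<close>.\<close>
proof (intro exI[of _ "nat \<lceil>exp (100000::real)\<rceil>"] allI impI ballI)
  fix V :: "'v set" and E :: "'v set set" and b :: "'v \<Rightarrow> real" and r :: "'v set \<Rightarrow> real" and v t
  assume G: "simple_graph V E" and n0: "card V \<ge> nat \<lceil>exp (100000::real)\<rceil>"
    and m: "real (card E) \<ge> real (card V) * ln (real (card V)) ^ 10"
    and b: "\<forall>v\<in>V. b v \<ge> 0" and r: "\<forall>e\<in>E. r e \<ge> 0"
    and v: "v \<in> V" and t: "t \<in> {0..num_rounds V E}"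
  define n where "n = real (card V)"
  define x where "x = ln n"
  define d where "d = avg_degree V E"
  define N where "N = real (num_machines V E)"
  define T where "T = num_rounds V E"
  have n: "n \<ge> exp 100000" using n0 unfolding n_def by linarith
  then have npos: "n > 0" using exp_gt_zero[of "100000::real"] by linarith
  have x: "x \<ge> 100000" using n npos by (simp add: x_def ln_ge_iff)
  have "n * x ^ 10 \<le> real (card E)" using m by (simp add: n_def x_def)
  then have "x ^ 10 \<le> real (card E) / n" using npos by (simp add: field_simps)
  moreover have "d = 2 * (real (card E) / n)" by (simp add: d_def avg_degree_def n_def)
  moreover have "x ^ 10 \<ge> 1" using x by (intro one_le_power) simp
  ultimately have d: "d \<ge> x ^ 10" "d \<ge> 1" by linarith+
  have "N = real_of_int \<lceil>sqrt d\<rceil>"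
    using d by (simp add: N_def num_machines_def d_def)
  then have N1: "N \<ge> sqrt d" "N \<le> sqrt d + 1" by linarith+
  have sd: "sqrt d \<ge> 1" using d by simp
  have "x ^ 5 = sqrt (x ^ 10)"
    using x real_sqrt_power[of "x\<^sup>2" 5] by (simp add: power_mult[symmetric])
  also have "\<dots> \<le> N" using N1 d by (meson order.trans real_sqrt_le_mono)
  finally have Nx: "x ^ 5 \<le> N" .
  have "(100000::real) ^ 5 \<le> x ^ 5" using x by (intro power_mono) auto
  with Nx have N5: "N \<ge> 10 ^ 5" by simp
  have Npos: "N > 0" using N5 by simp
  \<comment> \<open>Rounding up at most doubles \<open>sqrt d\<close>, as \<open>d\<close> is at
    least 1.\<close>
  have "N \<le> 2 * sqrt d" using N1 sd by linarith
  then have "N\<^sup>2 \<le> (2 * sqrt d)\<^sup>2" using Npos by (intro power_mono) auto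
  then have Nd: "N\<^sup>2 \<le> 4 * d" using d by (simp add: power_mult_distrib)
  define \<epsilon> where "\<epsilon> = N powr (- 0.2)"
  \<comment> \<open>The exponent lies below 1/2 so that \<open>\<theta>\<^sup>2 * c * 2 ^ T\<close>
    stays bounded, with slack for the factors \<open>2 ^ T\<close>. It exceeds 0.2 by enough that
    \<open>\<theta> * \<epsilon>\<close>, which is \<open>N powr 0.28 / 2\<close>, outgrows
    \<open>ln n\<close> when \<open>N\<close> is at least the fifth power of
    \<open>ln n\<close>.\<close>
  define \<theta> where "\<theta> = N powr 0.48 / 2"
  \<comment> \<open>The cap of \<open>u\<close> is at most \<open>b u / d\<close> and
    \<open>d\<close> is at least \<open>N\<^sup>2 / 4\<close>; this gives the 4 and, after
    multiplying by \<open>N\<close>, the single \<open>N\<close> below.\<close>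
  define c where "c = 4 * 2 ^ T / N"
  \<comment> \<open>Chosen so that \<open>3 * exp (- L)\<close>, summed over \<open>n\<close>
    vertices, is exactly \<open>1 / n\<close>.\<close>
  define L where "L = 2 * x + ln 3"
  have T: "2 ^ T \<le> N powr 0.001"
  proof -
    have "log 2 N \<ge> 0" using N5 by simp
    then have "real T \<le> log 2 N / 1000"
      unfolding T_def num_rounds_def N_def[symmetric]
      using of_int_floor_le[of "log 2 N / 1000"] by simp
    then have "2 powr real T \<le> 2 powr (log 2 N / 1000)" by simp
    also have "2 powr (log 2 N / 1000) = (2 powr log 2 N) powr 0.001" by (simp add: powr_powr)
    also have "2 powr log 2 N = N" using Npos by simp
    finally show ?thesis by (simp add: powr_realpow)
  qed
  have eps: "0 \<le> \<epsilon>" "\<epsilon> \<le> 0.1"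
  proof -
    show "0 \<le> \<epsilon>" by (simp add: \<epsilon>_def)
    have "10 = (10 powr 5) powr (0.2::real)" by (simp only: powr_powr) simp
    also have "\<dots> \<le> N powr 0.2" using N5 by (intro powr_mono2) (auto simp: powr_numeral)
    finally show "\<epsilon> \<le> 0.1" using Npos by (simp add: \<epsilon>_def powr_minus field_simps)
  qed
  have th0: "\<theta> > 0" using Npos by (simp add: \<theta>_def)
  have th1: "\<theta> * c \<le> 1"
  proof -
    have "\<theta> * c = 2 * N powr 0.48 * 2 ^ T / N" by (simp add: \<theta>_def c_def)
    also have "\<dots> \<le> 2 * N powr 0.48 * N powr 0.001 / N"
      using T Npos by (intro divide_right_mono mult_left_mono) auto
    also have "\<dots> = 2 * N powr (0.48 + 0.001 - 1)"
      using Npos by (simp only: powr_add powr_diff powr_one less_imp_le mult.assoc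
        times_divide_eq_right)
    \<comment> \<open>The exponent -0.519 is below -0.2, so the bound on \<epsilon> can be
      reused.\<close>
    also have "\<dots> \<le> 2 * \<epsilon>"
      unfolding \<epsilon>_def using N5 by (intro mult_left_mono powr_mono) auto
    finally show ?thesis using eps by simp
  qed
  have th2: "\<theta>\<^sup>2 * c * 2 ^ T \<le> 1"
  proof -
    have "\<theta>\<^sup>2 = N powr 0.96 / 4"
      by (simp add: \<theta>_def power_divide power2_eq_square powr_add[symmetric])
    then have "\<theta>\<^sup>2 * c * 2 ^ T = N powr 0.96 * (2 ^ T * 2 ^ T) / N" by (simp add: c_def)
    also have "\<dots> \<le> N powr 0.96 * (N powr 0.001 * N powr 0.001) / N"
      using T Npos by (intro divide_right_mono mult_left_mono mult_mono) auto
    also have "\<dots> = N powr (0.96 + (0.001 + 0.001) - 1)"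
      using Npos by (simp only: powr_add powr_diff powr_one less_imp_le)
    also have "\<dots> \<le> N powr 0" using N5 by (intro powr_mono) auto
    finally show ?thesis using Npos by simp
  qed
  have th3: "L + 1 \<le> \<theta> * \<epsilon>"
  proof -
    \<comment> \<open>The aim is \<open>10 * x \<le> N powr 0.28\<close>: since \<open>x ^ 5\<close>
      is at most \<open>N\<close>, the right side is at least \<open>x powr 1.4\<close>, and
      \<open>x powr 0.2\<close> alone already supplies the factor 10.\<close>
    have "10 = (10 powr 5) powr (0.2::real)" by (simp only: powr_powr) simp
    also have "\<dots> \<le> x powr 0.2" using x by (intro powr_mono2) (auto simp: powr_numeral)
    finally have "x * 10 \<le> x * x powr 0.2" using x by (intro mult_left_mono) auto
    also have "\<dots> = x powr 1.2" using x powr_add[of x 1 "0.2"] by simp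
    also have "\<dots> \<le> x powr 1.4" using x by (intro powr_mono) auto
    also have "\<dots> = (x powr 5) powr 0.28" by (simp add: powr_powr)
    also have "\<dots> = (x ^ 5) powr 0.28" using x by (simp add: powr_numeral)
    also have "\<dots> \<le> N powr 0.28" using Nx x by (intro powr_mono2) auto
    finally have "5 * x \<le> N powr 0.28 / 2" by simp
    also have "\<dots> = \<theta> * \<epsilon>" by (simp add: \<theta>_def \<epsilon>_def powr_add[symmetric])
    finally have "5 * x \<le> \<theta> * \<epsilon>" .
    moreover have "ln (3::real) \<le> 2" using ln_le_minus_one[of "3::real"] by simp
    ultimately show ?thesis using x by (simp add: L_def)
  qed
  interpret coupled_run V E b r
    using G b r d by unfold_locales (auto simp: d_def)
  have c: "real (num_machines V E) * (2 ^ num_rounds V E * vertex_cap V E b u) \<le> c * b u" if u: "u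
    \<in> V" for u
  proof -
    have bu: "b u \<ge> 0" using b u by simp
    have "vertex_cap V E b u \<le> 1 * b u / d"
      unfolding vertex_cap_def d_def[symmetric] using d bu by (intro frac_le mult_right_mono) auto
    also have "\<dots> \<le> b u / (N\<^sup>2 / 4)"
      using Nd Npos d bu by (intro frac_le) auto
    finally have "N * (2 ^ T * vertex_cap V E b u) \<le> N * (2 ^ T * (b u / (N\<^sup>2 / 4)))"
      using Npos by (intro mult_left_mono) auto
    also have "\<dots> = c * b u" using Npos by (simp add: c_def power2_eq_square)
    finally show ?thesis by (simp add: N_def T_def)
  qed
  have c0: "c \<ge> 0" using Npos by (simp add: c_def)
  have "\<P>((thr, i) in coupling V E b. v \<in> sym_diff (seq_active V E b r thr t) (mpc_active V E b r
    thr i t))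
      = measure coup {\<omega> \<in> space coup. v \<in> sym_diff (sa (fst \<omega>) t) (ma (fst \<omega>) (snd \<omega>) t)}"
    by (simp only: case_prod_unfold prod.collapse)
  also have "\<dots> \<le> real t * (real (card V) * (3 * exp (- L))) + (\<Sum>s<t. 5 * (13 ^ s * \<epsilon>))"
    using prob_sym_diff_le[OF v _ eps th0 th1 th2[unfolded T_def] th3 c0 c] t by simp
  also have "real (card V) * (3 * exp (- L)) = 1 / n"
  proof -
    have "exp L = exp x * exp x * exp (ln 3)" by (simp only: L_def mult_2 exp_add)
    also have "\<dots> = n * n * 3" using npos by (simp add: x_def)
    finally have "exp (- L) = 1 / (n * n * 3)" by (simp add: exp_minus inverse_eq_divide)
    then show ?thesis using npos by (simp add: n_def[symmetric])
  qed
  also have "(\<Sum>s<t. 5 * (13 ^ s * \<epsilon>)) = \<epsilon> * (\<Sum>s<t. 5 * 13 ^ s)"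
    by (simp add: sum_distrib_left mult_ac)
  also have "\<dots> \<le> \<epsilon> * (\<Sum>l=0..t. 100 ^ l)"
    using eps by (intro mult_left_mono sum_13_le_sum_100) auto
  also have "\<dots> = (\<Sum>l=0..t. rho V E l)"
    by (simp add: rho_def \<epsilon>_def N_def sum_distrib_left)
  finally show "\<P>((thr, i) in coupling V E b. v \<in> sym_diff (seq_active V E b r thr t) (mpc_active
    V E b r thr i t))
      \<le> real t / real (card V) + (\<Sum>l=0..t. rho V E l)"
    by (simp add: n_def)
qed

end
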